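(* Let $k\ge0$ be an integer, $\delta\in(-1,\infty)$, $b_m:=k-m+1+\delta(k-m)$ for $m=0,\dots,k$, and $\tau:=k+2+\delta(k+1)$. Let $(D_\infty^{(0)},\dots,D_\infty^{(k)})$ be a random vector with $\mathbb P(D_\infty^{(m)}=i_m,\ m=0,\dots,k)=p_{i_0,\dots,i_k}$ for $1\le i_k<\cdots<i_0$, where $(p_{i_0,\dots,i_k})$ is the probability mass function given by the recursion in the context. Let $Z$ be a random variable with density $f_Z(z)=\frac{\tau}{b_0}z^{-(1+\tau/b_0)}$, $z\ge1$, and, conditionally on $Z=z$, let $T_m$ $(0\le m\le k)$ and $(N^{(m)}_{0,j},\dots,N^{(m)}_{m-1,j})$ $(j\ge1,\ 1\le m\le k)$ be the random elements constructed in the context. Then the random vector $$ \Big(k-i+1+T_i+\sum_{m=i+1}^k\sum_{j=1}^{T_m}N^{(m)}_{i,j},\ \ i=0,\dots,k\Big) $$ has the same law as $(D_\infty^{(0)},\dots,D_\infty^{(k)})$. Furthermore, for every fixed $Z=z$ and every $0\le i<m\le k$, (conditionally on $Z=z$) $\sum_{j=1}^{T_m}N^{(m)}_{i,j}$ has the negative binomial distribution $p^{\rm NB}_{(1+\delta)/b_i,\,z^{-b_i/b_0}}$.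
   Context: Recursion: $(p_{i_0,\dots,i_k})_{1\le i_k<\cdots<i_0}$ is the probability mass function determined by $$ \begin{aligned} p_{i_0,\dots,i_k} &= \frac{i_k-1+\delta}{\tau}\, p_{i_0-1,\dots,i_k-1} +\sum_{m=0}^{k-1}\frac{(i_m-1-k+m)b_m-(i_{m+1}-k+m+1)b_{m+1}}{\tau}\,p_{i_0-1,\dots,i_m-1,i_{m+1},\dots,i_k}\\ &\quad-\frac{(i_0-k)b_0+\delta}{\tau}\,p_{i_0,\dots,i_k}+\mathbf 1\{i_\ell=k-\ell+1,\ \ell=0,\dots,k\}, \end{aligned} $$ with $p_{j_0,\dots,j_k}:=0$ whenever $1\le j_k<\cdots<j_0$ fails. Distributions. For $r>0$, $a\in(0,1)$, $p^{\rm NB}_{r,a}$ is the pmf $p^{\rm NB}_{r,a}(\ell)=\frac{\Gamma(\ell+r)}{\ell!\,\Gamma(r)}(1-a)^\ell a^r$, $\ell=0,1,2,\dots$. For $\kappa\in(0,1)$, $a\in(0,1)$, $p^{\rm TNB}_{\kappa,a}$ (extended truncated negative binomial) is the pmf $p^{\rm TNB}_{\kappa,a}(\ell)=\frac{\kappa\,\Gamma(\ell-\kappa)}{\ell!\,\Gamma(1-\kappa)}\cdot\frac{(1-a)^\ell}{1-a^\kappa}$, $\ell=1,2,\dots$. Construction, conditionally on $Z=z>1$. First, $N^{(1)}_0\sim p^{\rm TNB}_{b_1/b_0,z^{-1}}$. For $2\le m\le k$, given the law of the $(m-1)$-dimensional vector $(N^{(m-1)}_0,\dots,N^{(m-1)}_{m-2})$,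 define the $m$-dimensional vector $(N^{(m)}_0,\dots,N^{(m)}_{m-1})$ by $N^{(m)}_{m-1}\sim p^{\rm TNB}_{b_m/b_{m-1},\,z^{-b_{m-1}/b_0}}$ and $N^{(m)}_i=\sum_{j=1}^{N^{(m)}_{m-1}}N^{(m-1)}_{i,j}$ for $i=0,\dots,m-2$, where $(N^{(m-1)}_{0,j},\dots,N^{(m-1)}_{m-2,j})$, $j\ge1$, are i.i.d. copies of $(N^{(m-1)}_0,\dots,N^{(m-1)}_{m-2})$, independent of $N^{(m)}_{m-1}$. Next, let $T_m\sim p^{\rm NB}_{(1+\delta)/b_m,\,z^{-b_m/b_0}}$ for $m=0,\dots,k$, and for each $m=1,\dots,k$ let $(N^{(m)}_{0,j},\dots,N^{(m)}_{m-1,j})$, $j\ge1$, be i.i.d. copies of $(N^{(m)}_0,\dots,N^{(m)}_{m-1})$; all these random elements (the $T_m$'s and the copies, for all $m$ and $j$) are independent given $Z=z$. *)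

theory Defs
  imports "HOL-Probability.Probability"
begin

definition bcoef :: "nat \<Rightarrow> real \<Rightarrow> nat \<Rightarrow> real" where
  "bcoef k \<delta> m = real k - real m + 1 + \<delta> * (real k - real m)"

definition tau :: "nat \<Rightarrow> real \<Rightarrow> real" where
  "tau k \<delta> = real k + 2 + \<delta> * (real k + 1)"

text \<open>An index \<open>(i\<^sub>0, \<dots>, i\<^sub>k)\<close> is the list \<open>[i\<^sub>0, \<dots>, i\<^sub>k]\<close>; it is admissible when
  \<open>1 \<le> i\<^sub>k < \<dots> < i\<^sub>0\<close>.\<close>

definition admissible :: "nat \<Rightarrow> nat list \<Rightarrow> bool" where
  "admissible k i \<longleftrightarrow> length i = Suc k \<and> 1 \<le> i ! k \<and> (\<forall>m<k. i ! Suc m < i ! m)"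

text \<open>Lower the first \<open>n\<close> coordinates by one. Truncated subtraction is harmless, because
  this is only applied to admissible indices, all of whose coordinates are positive.\<close>

definition lower :: "nat \<Rightarrow> nat list \<Rightarrow> nat list" where
  "lower n i = map (\<lambda>x. x - 1) (take n i) @ drop n i"

definition degree_recursion :: "nat \<Rightarrow> real \<Rightarrow> (nat list \<Rightarrow> real) \<Rightarrow> bool" where
  "degree_recursion k \<delta> p \<longleftrightarrow>
     (\<forall>i. \<not> admissible k i \<longrightarrow> p i = 0) \<and>
     (\<forall>i. admissible k i \<longrightarrow>
        p i = (real (i ! k) - 1 + \<delta>) / tau k \<delta> * p (lower (Suc k) i)
          + (\<Sum>m<k. ((real (i ! m) - 1 - real k + real m) * bcoef k \<delta> m
                     - (real (i ! Suc m) - real k + real m + 1) * bcoef k \<delta> (Suc m)) / tau k \<delta>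
                   * p (lower (Suc m) i))
          - ((real (i ! 0) - real k) * bcoef k \<delta> 0 + \<delta>) / tau k \<delta> * p i
          + (if \<forall>l\<le>k. i ! l = k - l + 1 then 1 else 0))"

definition p_NB :: "real \<Rightarrow> real \<Rightarrow> nat \<Rightarrow> real" where
  "p_NB r a l = Gamma (real l + r) / (fact l * Gamma r) * (1 - a) ^ l * a powr r"

definition p_TNB :: "real \<Rightarrow> real \<Rightarrow> nat \<Rightarrow> real" where
  "p_TNB \<kappa> a l =
     (if l = 0 then 0
      else \<kappa> * Gamma (real l - \<kappa>) / (fact l * Gamma (1 - \<kappa>)) * ((1 - a) ^ l / (1 - a powr \<kappa>)))"

definition NB :: "real \<Rightarrow> real \<Rightarrow> nat measure" where
  "NB r a = point_measure UNIV (\<lambda>l. ennreal (p_NB r a l))"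

definition TNB :: "real \<Rightarrow> real \<Rightarrow> nat measure" where
  "TNB \<kappa> a = point_measure UNIV (\<lambda>l. ennreal (p_TNB \<kappa> a l))"

text \<open>Law, given \<open>Z = z\<close>, of the \<open>m\<close>-dimensional vector \<open>N(m)\<close> of the construction,
  as a law on lists of length \<open>m\<close>. The empty vector for \<open>m = 0\<close> only starts the
  recursion: for \<open>m = 1\<close> there are no random sums and the second parameter is
  \<open>z powr (- 1)\<close>, so the law is that of a single truncated negative binomial variable.
  In the successor step, \<open>n\<close> is the last coordinate and \<open>x 1, x 2, \<dots>\<close> are the
  i.i.d. copies of the vector of the previous dimension.\<close>

primrec N_law :: "nat \<Rightarrow> real \<Rightarrow> real \<Rightarrow> nat \<Rightarrow> nat list measure" where
  "N_law k \<delta> z 0 = return (count_space UNIV) []"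
| "N_law k \<delta> z (Suc m) =
     distr (TNB (bcoef k \<delta> (Suc m) / bcoef k \<delta> m) (z powr (- (bcoef k \<delta> m / bcoef k \<delta> 0)))
              \<Otimes>\<^sub>M PiM {1::nat..} (\<lambda>j. N_law k \<delta> z m))
       (count_space UNIV)
       (\<lambda>(n, x). map (\<lambda>i. \<Sum>j=1..n. x j ! i) [0..<m] @ [n])"

text \<open>Value space and conditional law, given \<open>Z = z\<close>, of the family consisting of the
  variables \<open>T m\<close> for \<open>m \<le> k\<close> and of the copies \<open>j \<ge> 1\<close> of the vectors \<open>N(m)\<close> for
  \<open>1 \<le> m \<le> k\<close>; the copies are indexed by the pairs \<open>(m, j)\<close>. The law is meaningful for
  \<open>z > 1\<close>, where the parameters of the distributions are in range.\<close>

definition TN_index :: "nat \<Rightarrow> (nat \<times> nat) set" where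
  "TN_index k = {1..k} \<times> {1..}"

definition TN_space :: "nat \<Rightarrow> ((nat \<Rightarrow> nat) \<times> (nat \<times> nat \<Rightarrow> nat list)) measure" where
  "TN_space k = PiM {..k} (\<lambda>m. count_space UNIV) \<Otimes>\<^sub>M PiM (TN_index k) (\<lambda>(m, j). count_space UNIV)"

definition TN_law :: "nat \<Rightarrow> real \<Rightarrow> real \<Rightarrow> ((nat \<Rightarrow> nat) \<times> (nat \<times> nat \<Rightarrow> nat list)) measure" where
  "TN_law k \<delta> z =
     PiM {..k} (\<lambda>m. NB ((1 + \<delta>) / bcoef k \<delta> m) (z powr (- (bcoef k \<delta> m / bcoef k \<delta> 0))))
       \<Otimes>\<^sub>M PiM (TN_index k) (\<lambda>(m, j). N_law k \<delta> z m)"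

text \<open>\<open>X\<close>, with values in \<open>S\<close>, has conditional law \<open>K z\<close> given \<open>Z = z\<close>:
  \<open>P(Z \<in> A, X \<in> B)\<close> is the integral of \<open>K z B\<close> over \<open>z \<in> A\<close> against the law of \<open>Z\<close>.\<close>

definition has_cond_law ::
  "'a measure \<Rightarrow> ('a \<Rightarrow> real) \<Rightarrow> 'b measure \<Rightarrow> ('a \<Rightarrow> 'b) \<Rightarrow> (real \<Rightarrow> 'b measure) \<Rightarrow> bool" where
  "has_cond_law M Z S X K \<longleftrightarrow>
     X \<in> measurable M S \<and>
     (\<forall>A\<in>sets borel. \<forall>B\<in>sets S.
        emeasure M {\<omega> \<in> space M. Z \<omega> \<in> A \<and> X \<omega> \<in> B}
          = (\<integral>\<^sup>+z\<in>A. emeasure (K z) B \<partial>distr M borel Z))"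

end

theory Submission
  imports Defs "HOL-Library.Function_Algebras" "HOL-Computational_Algebra.Formal_Power_Series"
    "HOL-Real_Asymp.Real_Asymp"
begin

text \<open>
  Write \<open>Y\<^sub>i\<close> for the \<open>i\<close>-th coordinate of the random vector minus \<open>k - i + 1\<close>. Given \<open>Z = z\<close>, an
  \<open>N(m + 1)\<close>-vector is a sum of truncated negative binomially many copies of the \<open>N(m)\<close>-vector, so
  \<open>Y\<^sub>k, Y\<^sub>k\<^sub>-\<^sub>1, \<dots>, Y\<^sub>0\<close> is a Markov chain: given \<open>Y\<^sub>j\<^sub>+\<^sub>1 = n\<close>, the law of \<open>Y\<^sub>j\<close> is the convolution of a
  negative binomial law with \<open>n\<close> truncated negative binomial laws. With \<open>a\<^sub>j = z powr (- b\<^sub>j / b\<^sub>0)\<close>, its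
  mass function at \<open>l\<close> is \<open>z powr (- (1 + \<delta>) / b\<^sub>0) * (1 - a\<^sub>j) ^ l / (1 - a\<^sub>j\<^sub>+\<^sub>1) ^ n * C\<^sub>j(n, l)\<close>, where
  \<open>C\<^sub>j(n, l)\<close> is the coefficient of \<open>x ^ l\<close> in
  \<open>(1 - x) powr (- (1 + \<delta>) / b\<^sub>j) * (1 - (1 - x) powr (b\<^sub>j\<^sub>+\<^sub>1 / b\<^sub>j)) ^ n\<close> and does not depend on \<open>z\<close>.
  In the product over \<open>j\<close> the powers of \<open>1 - a\<^sub>j\<close> telescope, and integrating over \<open>z\<close> leaves a
  beta integral in \<open>Y\<^sub>0\<close> times \<open>\<Prod>\<^sub>j C\<^sub>j(Y\<^sub>j\<^sub>+\<^sub>1, Y\<^sub>j)\<close>. The differential equation of the power series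
  gives a linear recursion for \<open>C\<^sub>j\<close>; multiplied over \<open>j\<close> it is the given recursion, whose solution is
  unique by induction on the first index.
\<close>

section \<open>Convolution of probability mass functions\<close>

definition conv_pmf :: "'a::comm_monoid_add pmf \<Rightarrow> 'a pmf \<Rightarrow> 'a pmf" where
  "conv_pmf p q = bind_pmf p (\<lambda>x. map_pmf (\<lambda>y. x + y) q)"

text \<open>The law of an independent sum depends neither on order nor on bracketing, so
  \<open>conv.F\<close> makes sense as the law of a sum of independent variables indexed by a finite
  set.\<close>

interpretation conv: comm_monoid_set conv_pmf "return_pmf 0"
proof
  fix p q r :: "'a pmf"
  show "conv_pmf (conv_pmf p q) r = conv_pmf p (conv_pmf q r)"
    by (simp add: conv_pmf_def map_pmf_def bind_assoc_pmf bind_return_pmf add.assoc)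
  show "conv_pmf p q = conv_pmf q p"
    unfolding conv_pmf_def map_pmf_def by (subst bind_commute_pmf) (simp add: add.commute)
  show "conv_pmf p (return_pmf 0) = p"
    by (simp add: conv_pmf_def bind_return_pmf')
qed

primrec conv_pow :: "'a::comm_monoid_add pmf \<Rightarrow> nat \<Rightarrow> 'a pmf" where
  "conv_pow p 0 = return_pmf 0"
| "conv_pow p (Suc n) = conv_pmf p (conv_pow p n)"

lemma conv_pow_return_0 [simp]: "conv_pow (return_pmf 0) n = return_pmf 0"
  by (induction n) simp_all

lemma conv_pow_add: "conv_pow p (m + n) = conv_pmf (conv_pow p m) (conv_pow p n)"
  by (induction m) (simp_all add: conv.assoc)

lemma conv_constant: "finite J \<Longrightarrow> conv.F (\<lambda>_. p) J = conv_pow p (card J)"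
  by (induction J rule: finite_induct) simp_all

lemma map_conv_pmf:
  assumes "\<And>x y. f (x + y) = f x + f y"
  shows "map_pmf f (conv_pmf p q) = conv_pmf (map_pmf f p) (map_pmf f q)"
  by (simp add: conv_pmf_def map_pmf_def bind_assoc_pmf bind_return_pmf assms)

lemma map_conv_pow:
  assumes "\<And>x y. f (x + y) = f x + f y" "f 0 = 0"
  shows "map_pmf f (conv_pow p n) = conv_pow (map_pmf f p) n"
  by (induction n) (simp_all add: map_conv_pmf assms)

text \<open>Coordinates under \<open>Pi_pmf\<close> are independent, and each summand looks at one
  coordinate only.\<close>

lemma map_sum_Pi_pmf:
  assumes "finite J"
  shows "map_pmf (\<lambda>x. \<Sum>j\<in>J. g j (x j)) (Pi_pmf J d Q) = conv.F (\<lambda>j. map_pmf (g j) (Q j)) J"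
  using assms
proof (induction J rule: finite_induct)
  case (insert j J)
  have "map_pmf (\<lambda>x. \<Sum>i\<in>insert j J. g i (x i)) (Pi_pmf (insert j J) d Q)
      = bind_pmf (Q j) (\<lambda>y. map_pmf (\<lambda>f. g j y + (\<Sum>i\<in>J. g i ((f(j := y)) i))) (Pi_pmf J d Q))"
    using insert.hyps
    by (simp add: Pi_pmf_insert' map_pmf_def bind_assoc_pmf bind_return_pmf)
  also have "\<dots> = bind_pmf (Q j) (\<lambda>y. map_pmf (\<lambda>f. g j y + (\<Sum>i\<in>J. g i (f i))) (Pi_pmf J d Q))"
    using insert.hyps by (intro bind_pmf_cong map_pmf_cong refl arg_cong2[where f = "(+)"] sum.cong) auto
  also have "\<dots> = conv_pmf (map_pmf (g j) (Q j)) (map_pmf (\<lambda>x. \<Sum>i\<in>J. g i (x i)) (Pi_pmf J d Q))"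
    by (simp add: conv_pmf_def map_pmf_def bind_assoc_pmf bind_return_pmf)
  finally show ?case
    using insert by simp
qed simp

text \<open>The summand \<open>e n\<close> keeps track of the count: with
  \<open>e = unit_vec m\<close> the number of terms is stored in coordinate \<open>m\<close>, with
  \<open>e\<close> constantly zero this is an ordinary random sum.\<close>

definition random_sum :: "nat pmf \<Rightarrow> 'a::comm_monoid_add pmf \<Rightarrow> (nat \<Rightarrow> 'a) \<Rightarrow> 'a pmf" where
  "random_sum Q V e = bind_pmf Q (\<lambda>n. map_pmf (\<lambda>v. v + e n) (conv_pow V n))"

text \<open>Given both counts, all summands are i.i.d., so the two sums pool into one with the total
  count. Exchanging the second count with the first sum brings the counts together.\<close>

lemma random_sum_conv:
  assumes "\<And>m n. e (m + n) = e m + e n"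
  shows "conv_pmf (random_sum P V e) (random_sum Q V e) = random_sum (conv_pmf P Q) V e"
proof -
  have "conv_pmf (random_sum P V e) (random_sum Q V e)
      = bind_pmf P (\<lambda>m. bind_pmf (conv_pow V m) (\<lambda>x. bind_pmf Q (\<lambda>n. bind_pmf (conv_pow V n) 
          (\<lambda>y. return_pmf (x + y + (e m + e n))))))"
    by (simp add: conv_pmf_def random_sum_def map_pmf_def bind_assoc_pmf bind_return_pmf ac_simps)
  also have "\<dots> = bind_pmf P (\<lambda>m. bind_pmf Q (\<lambda>n. bind_pmf (conv_pow V m) (\<lambda>x. bind_pmf (conv_pow V n) 
          (\<lambda>y. return_pmf (x + y + (e m + e n))))))"
    by (subst bind_commute_pmf) (rule refl)
  also have "\<dots> = random_sum (conv_pmf P Q) V e"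
    by (simp add: random_sum_def conv_pmf_def conv_pow_add map_pmf_def bind_assoc_pmf bind_return_pmf assms)
  finally show ?thesis .
qed

lemma conv_pow_random_sum:
  assumes "\<And>m n. e (m + n) = e m + e n" "e 0 = 0"
  shows "conv_pow (random_sum Q V e) n = random_sum (conv_pow Q n) V e"
proof (induction n)
  case 0
  show ?case by (simp add: random_sum_def bind_return_pmf assms)
next
  case (Suc n)
  then show ?case by (simp add: random_sum_conv assms)
qed

text \<open>Two generations contract into one: the total number of elementary summands is itself a
  random sum of the inner counts.\<close>

lemma random_sum_assoc:
  assumes "\<And>m n. e (m + n) = e m + e n" "e 0 = 0"
  shows "random_sum P (random_sum Q V e) (\<lambda>_. 0) = random_sum (random_sum P Q (\<lambda>_. 0)) V e"
proof -
  have "random_sum P (random_sum Q V e) (\<lambda>_. 0) = bind_pmf P (\<lambda>n. random_sum (conv_pow Q n) V e)"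
    by (subst random_sum_def) (simp add: conv_pow_random_sum assms)
  then show ?thesis
    by (simp add: random_sum_def bind_assoc_pmf)
qed

section \<open>The Markov chain of coordinates\<close>

definition unit_vec :: "nat \<Rightarrow> nat \<Rightarrow> (nat \<Rightarrow> nat)" where
  "unit_vec m n = (\<lambda>i. if i = m then n else 0)"

lemma unit_vec_add: "unit_vec m (a + b) = unit_vec m a + unit_vec m b"
  by (auto simp: unit_vec_def)

lemma unit_vec_0 [simp]: "unit_vec m 0 = 0"
  by (auto simp: unit_vec_def)

text \<open>
  Vectors are extended by zero. In the application \<open>offspring Q m\<close> is the law of the vector \<open>N(m)\<close>,
  \<open>total P Q m\<close> is the joint law of the contributions of \<open>T\<^sub>0, \<dots>, T\<^sub>m\<^sub>-\<^sub>1\<close>, and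
  \<open>total_given P Q m n\<close> is the law of \<open>(Y\<^sub>0, \<dots>, Y\<^sub>m\<^sub>-\<^sub>1)\<close> given \<open>Y\<^sub>m = n\<close>.
\<close>

primrec offspring :: "(nat \<Rightarrow> nat pmf) \<Rightarrow> nat \<Rightarrow> (nat \<Rightarrow> nat) pmf" where
  "offspring Q 0 = return_pmf 0"
| "offspring Q (Suc m) = random_sum (Q m) (offspring Q m) (unit_vec m)"

primrec total :: "(nat \<Rightarrow> nat pmf) \<Rightarrow> (nat \<Rightarrow> nat pmf) \<Rightarrow> nat \<Rightarrow> (nat \<Rightarrow> nat) pmf" where
  "total P Q 0 = return_pmf 0"
| "total P Q (Suc m) = conv_pmf (total P Q m) (random_sum (P m) (offspring Q m) (unit_vec m))"

definition total_given :: "(nat \<Rightarrow> nat pmf) \<Rightarrow> (nat \<Rightarrow> nat pmf) \<Rightarrow> nat \<Rightarrow> nat \<Rightarrow> (nat \<Rightarrow> nat) pmf" where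
  "total_given P Q m n = conv_pmf (total P Q m) (conv_pow (offspring Q m) n)"

lemma total_given_0: "total_given P Q m 0 = total P Q m"
  by (simp add: total_given_def)

text \<open>One step of the Markov chain. Coordinate \<open>m\<close> collects the immigrants
  \<open>P m\<close> and the last entries of \<open>n\<close> copies of the
  \<open>(m + 1)\<close>-vector; given its value \<open>l\<close>, the lower coordinates come from
  \<open>total P Q m\<close> and \<open>l\<close> copies of the \<open>m\<close>-vector.\<close>

lemma total_given_Suc:
  "total_given P Q (Suc m) n =
     bind_pmf (conv_pmf (P m) (conv_pow (Q m) n)) (\<lambda>l. map_pmf (\<lambda>w. w + unit_vec m l) (total_given P Q m l))"
proof -
  have "total_given P Q (Suc m) n
      = conv_pmf (total P Q m) (random_sum (conv_pmf (P m) (conv_pow (Q m) n)) (offspring Q m) (unit_vec m))"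
    by (simp add: total_given_def conv_pow_random_sum random_sum_conv unit_vec_add conv.assoc)
  also have "\<dots> = bind_pmf (conv_pmf (P m) (conv_pow (Q m) n)) (\<lambda>l. map_pmf (\<lambda>w. w + unit_vec m l) (total_given P Q m l))"
    unfolding conv_pmf_def[of "total P Q m"] random_sum_def total_given_def map_bind_pmf
    by (subst bind_commute_pmf) (simp add: map_pmf_def bind_assoc_pmf bind_return_pmf ac_simps)
  finally show ?thesis .
qed

lemma set_pmf_conv: "set_pmf (conv_pmf p q) = (\<Union>x\<in>set_pmf p. (\<lambda>y. x + y) ` set_pmf q)"
  by (simp add: conv_pmf_def)

lemma set_pmf_conv_pow_vanish:
  assumes "\<And>v. v \<in> set_pmf V \<Longrightarrow> v i = (0::nat)" and "v \<in> set_pmf (conv_pow V n)"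
  shows "v i = 0"
  using assms(2) by (induction n arbitrary: v) (auto simp: set_pmf_conv assms(1))

lemma set_pmf_offspring_vanish: "v \<in> set_pmf (offspring Q m) \<Longrightarrow> m \<le> i \<Longrightarrow> v i = 0"
proof (induction m arbitrary: v)
  case (Suc m)
  then obtain n w where "w \<in> set_pmf (conv_pow (offspring Q m) n)" "v = w + unit_vec m n"
    by (auto simp: random_sum_def)
  with Suc set_pmf_conv_pow_vanish[of "offspring Q m" i w n] show ?case
    by (auto simp: unit_vec_def)
qed auto

lemma set_pmf_total_given_vanish: "v \<in> set_pmf (total_given P Q m n) \<Longrightarrow> m \<le> i \<Longrightarrow> v i = 0"
proof (induction m arbitrary: v n)
  case 0
  then show ?case
    by (simp add: total_given_def)
next
  case (Suc m)
  then obtain l w where "w \<in> set_pmf (total_given P Q m l)" "v = w + unit_vec m l"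
    by (auto simp: total_given_Suc)
  with Suc show ?case
    by (auto simp: unit_vec_def)
qed

lemma pmf_bind_single:
  assumes "\<And>x. x \<noteq> a \<Longrightarrow> x \<in> set_pmf p \<Longrightarrow> pmf (f x) y = 0"
  shows "pmf (bind_pmf p f) y = pmf p a * pmf (f a) y"
proof -
  have "pmf (bind_pmf p f) y = measure_pmf.expectation p (\<lambda>x. indicator {a} x * pmf (f a) y)"
    unfolding pmf_bind
    by (intro integral_cong_AE AE_pmfI) (auto simp: assms indicator_def)
  then show ?thesis
    by (simp add: measure_pmf_single)
qed

text \<open>The vector displays every intermediate state, so in each mixture over states a single
  value contributes, and a product of transition probabilities remains.\<close>

lemma pmf_total_given:
  "pmf (total_given P Q m (v m)) (\<lambda>i. if i < m then v i else 0) =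
     (\<Prod>j<m. pmf (conv_pmf (P j) (conv_pow (Q j) (v (Suc j)))) (v j))"
proof (induction m)
  case 0
  have "(\<lambda>i. if i < 0 then v i else 0) = 0"
    by auto
  then show ?case by (simp add: total_given_def)
next
  case (Suc m)
  define u where "u = (\<lambda>i. if i < Suc m then v i else 0)"
  define u' where "u' = (\<lambda>i. if i < m then v i else 0)"
  have u: "u = u' + unit_vec m (v m)"
    by (auto simp: u_def u'_def unit_vec_def)
  \<comment> \<open>Vectors from \<open>total_given P Q m l\<close> are zero in coordinate
    \<open>m\<close>, so after adding \<open>unit_vec m l\<close> this coordinate reveals
    \<open>l\<close>.\<close>
  have vanish: "pmf (map_pmf (\<lambda>w. w + unit_vec m l) (total_given P Q m l)) u = 0" if "l \<noteq> v m" for l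
  proof (rule ccontr)
    assume "\<not> ?thesis"
    then obtain w where w: "w \<in> set_pmf (total_given P Q m l)" "u = w + unit_vec m l"
      by (auto simp: pmf_eq_0_set_pmf)
    then have "u m = l"
      using set_pmf_total_given_vanish[OF w(1), of m] by (simp add: unit_vec_def)
    with that show False by (simp add: u_def)
  qed
  have "pmf (total_given P Q (Suc m) (v (Suc m))) u =
      pmf (conv_pmf (P m) (conv_pow (Q m) (v (Suc m)))) (v m) *
      pmf (map_pmf (\<lambda>w. w + unit_vec m (v m)) (total_given P Q m (v m))) u"
    unfolding total_given_Suc by (intro pmf_bind_single vanish)
  also have "pmf (map_pmf (\<lambda>w. w + unit_vec m (v m)) (total_given P Q m (v m))) u
      = pmf (total_given P Q m (v m)) u'"
    unfolding u by (rule pmf_map_inj') (auto intro!: injI)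
  finally show ?case
    using Suc by (simp add: u_def u'_def)
qed

lemma map_random_sum:
  assumes "\<And>x y. f (x + y) = f x + f y" "f 0 = 0"
  shows "map_pmf f (random_sum Q V e) = random_sum Q (map_pmf f V) (\<lambda>n. f (e n))"
  by (simp add: random_sum_def map_bind_pmf map_pmf_comp assms flip: map_conv_pow[OF assms])

text \<open>The last entry of the \<open>(m + 1)\<close>-vector has law \<open>Q m\<close>, so
  passing down one level turns the count \<open>P (Suc m)\<close> into \<open>P m\<close>; this
  repeats until level \<open>i\<close> is reached.\<close>

lemma random_sum_marginal:
  assumes "\<And>m. Suc m \<le> k \<Longrightarrow> random_sum (P (Suc m)) (Q m) (\<lambda>_. 0) = P m"
  shows "i < m \<Longrightarrow> m \<le> k \<Longrightarrow> random_sum (P m) (map_pmf (\<lambda>v. v i) (offspring Q m)) (\<lambda>_. 0) = P i"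
proof (induction m)
  case (Suc m)
  show ?case
  proof (cases "i = m")
    case True
    \<comment> \<open>Every copy of the \<open>m\<close>-vector is zero in coordinate
      \<open>m\<close>, so only the count is left there.\<close>
    have "map_pmf (\<lambda>v. v m + n) (conv_pow (offspring Q m) n) = return_pmf n" for n
    proof -
      have "map_pmf (\<lambda>v. v m + n) (conv_pow (offspring Q m) n) = map_pmf (\<lambda>_. n) (conv_pow (offspring Q m) n)"
        by (rule map_pmf_cong) (auto intro: set_pmf_conv_pow_vanish set_pmf_offspring_vanish)
      then show ?thesis by simp
    qed
    then have "map_pmf (\<lambda>v. v m) (offspring Q (Suc m)) = Q m"
      by (simp add: random_sum_def map_bind_pmf map_pmf_comp unit_vec_def bind_return_pmf')
    with True assms Suc.prems show ?thesis by simp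
  next
    case False
    then have "map_pmf (\<lambda>v. v i) (offspring Q (Suc m))
        = random_sum (Q m) (map_pmf (\<lambda>v. v i) (offspring Q m)) (\<lambda>_. 0)"
      by (simp add: map_random_sum unit_vec_def)
    with False Suc assms[of m] show ?thesis
      by (simp add: random_sum_assoc)
  qed
qed simp

section \<open>Product measures and sums of coordinates\<close>

lemma measurable_count_space_UNIV:
  "f \<in> M \<rightarrow>\<^sub>M count_space C \<Longrightarrow> f \<in> M \<rightarrow>\<^sub>M count_space UNIV"
  by (rule measurable_compose[where g = "\<lambda>x. x" and N = "count_space C"]) simp_all

text \<open>The product over \<open>I\<close> need not be discrete, but its image on a finite
  \<open>J\<close> is, so comparing point masses suffices. The default \<open>undefined\<close> is
  the value that \<open>restrict\<close> takes outside \<open>J\<close>.\<close>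

lemma restrict_PiM_pmf:
  fixes Q :: "'i \<Rightarrow> 'b::countable pmf"
  assumes "finite J" "J \<subseteq> I"
  shows measurable_restrict_PiM_pmf:
      "(\<lambda>x. restrict x J) \<in> PiM I (\<lambda>j. measure_pmf (Q j)) \<rightarrow>\<^sub>M count_space (PiE J (\<lambda>_. UNIV))" (is ?A)
    and distr_restrict_PiM_pmf:
      "distr (PiM I (\<lambda>j. measure_pmf (Q j))) (count_space UNIV) (\<lambda>x. restrict x J)
         = measure_pmf (Pi_pmf J undefined Q)" (is ?B)
proof -
  let ?P = "PiM I (\<lambda>j. measure_pmf (Q j))"
  interpret product_prob_space "\<lambda>j. measure_pmf (Q j)" I
    by unfold_locales
  have "(\<lambda>x. restrict x J) \<in> ?P \<rightarrow>\<^sub>M PiM J (\<lambda>j. measure_pmf (Q j))"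
    using assms by (intro measurable_restrict_subset)
  also have "measurable ?P (PiM J (\<lambda>j. measure_pmf (Q j))) = measurable ?P (PiM J (\<lambda>j. count_space UNIV))"
    by (intro measurable_cong_sets sets_PiM_cong) auto
  also have "PiM J (\<lambda>j. count_space (UNIV :: 'b set)) = count_space (PiE J (\<lambda>_. UNIV))"
    using assms by (intro count_space_PiM_finite) auto
  finally show A: ?A .
  then have A': "(\<lambda>x. restrict x J) \<in> ?P \<rightarrow>\<^sub>M count_space UNIV"
    by (rule measurable_count_space_UNIV)
  have ctbl: "countable (PiE J (\<lambda>_. UNIV :: 'b set))"
    using assms by (intro countable_PiE) auto
  show ?B
  proof (rule measure_eqI_countable_AE[where \<Omega> = "PiE J (\<lambda>_. UNIV)"])
    show "AE x in distr ?P (count_space UNIV) (\<lambda>x. restrict x J). x \<in> J \<rightarrow>\<^sub>E UNIV"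
      by (subst AE_distr_iff[OF A']) auto
    show "AE x in measure_pmf (Pi_pmf J undefined Q). x \<in> J \<rightarrow>\<^sub>E UNIV"
      using set_Pi_pmf_subset[OF assms(1), of undefined Q]
      by (intro AE_pmfI) (auto simp: PiE_def extensional_def)
  next
    fix f :: "'i \<Rightarrow> 'b" assume f: "f \<in> J \<rightarrow>\<^sub>E UNIV"
    have "restrict x J = f" if "restrict x J \<in> (\<Pi> j\<in>J. {f j})" for x
      using f that by (intro ext) (auto simp: PiE_def extensional_def restrict_def Pi_def split: if_splits)
    then have "emeasure (distr ?P (count_space UNIV) (\<lambda>x. restrict x J)) {f}
        = emeasure ?P (prod_emb I (\<lambda>j. measure_pmf (Q j)) J (PiE J (\<lambda>j. {f j})))"
      using f assms by (subst emeasure_distr[OF A'])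
        (auto simp: prod_emb_def space_PiM PiE_singleton PiE_def intro!: arg_cong[where f = "emeasure _"])
    also have "\<dots> = (\<Prod>j\<in>J. ennreal (pmf (Q j) (f j)))"
      using assms by (subst emeasure_PiM_emb) (auto simp: emeasure_pmf_single)
    also have "\<dots> = emeasure (measure_pmf (Pi_pmf J undefined Q)) {f}"
      using f assms by (simp add: emeasure_pmf_single pmf_Pi PiE_def extensional_def prod_ennreal)
    finally show "emeasure (distr ?P (count_space UNIV) (\<lambda>x. restrict x J)) {f} =
      emeasure (measure_pmf (Pi_pmf J undefined Q)) {f}" .
  qed (use ctbl in auto)
qed

lemma sum_PiM_pmf:
  fixes Q :: "'i \<Rightarrow> 'b::countable pmf" and g :: "'i \<Rightarrow> 'b \<Rightarrow> 'c::comm_monoid_add"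
  assumes "finite J" "J \<subseteq> I"
  shows measurable_sum_PiM_pmf:
      "(\<lambda>x. \<Sum>j\<in>J. g j (x j)) \<in> PiM I (\<lambda>j. measure_pmf (Q j)) \<rightarrow>\<^sub>M count_space UNIV" (is ?A)
    and distr_sum_PiM_pmf:
      "distr (PiM I (\<lambda>j. measure_pmf (Q j))) (count_space UNIV) (\<lambda>x. \<Sum>j\<in>J. g j (x j))
         = measure_pmf (conv.F (\<lambda>j. map_pmf (g j) (Q j)) J)" (is ?B)
proof -
  let ?P = "PiM I (\<lambda>j. measure_pmf (Q j))" and ?S = "\<lambda>x. \<Sum>j\<in>J. g j (x j)"
  have *: "?S = ?S \<circ> (\<lambda>x. restrict x J)"
    by (auto intro!: sum.cong)
  have R: "(\<lambda>x. restrict x J) \<in> ?P \<rightarrow>\<^sub>M count_space UNIV"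
    using measurable_restrict_PiM_pmf[OF assms, of Q] by (rule measurable_count_space_UNIV)
  show ?A
    by (subst *) (rule measurable_comp[OF R], simp)
  have "distr ?P (count_space UNIV) ?S
      = distr (distr ?P (count_space UNIV) (\<lambda>x. restrict x J)) (count_space UNIV) ?S"
    by (subst *, subst distr_distr[OF _ R]) auto
  also have "\<dots> = measure_pmf (map_pmf ?S (Pi_pmf J undefined Q))"
    by (simp add: distr_restrict_PiM_pmf[OF assms] map_pmf_rep_eq)
  finally show ?B
    by (simp add: map_sum_Pi_pmf[OF assms(1)])
qed

text \<open>The number of copies summed is random, so the index set depends on the first component.
  Fubini freezes that component and leaves a sum over a fixed finite set.\<close>

lemma random_sum_PiM_pmf:
  fixes Q :: "'i \<Rightarrow> 'b::countable pmf" and g :: "'i \<Rightarrow> 'b \<Rightarrow> 'c::comm_monoid_add"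
  assumes A: "prob_space A" "countable C" "r \<in> A \<rightarrow>\<^sub>M count_space C"
    and P: "distr A (count_space UNIV) r = measure_pmf P"
    and J: "\<And>t. finite (J t)" "\<And>t. J t \<subseteq> I"
  shows measurable_random_sum_PiM_pmf:
      "(\<lambda>(t, x). h (r t) + (\<Sum>j\<in>J (r t). g j (x j))) \<in> A \<Otimes>\<^sub>M PiM I (\<lambda>j. measure_pmf (Q j)) \<rightarrow>\<^sub>M count_space UNIV"
        (is "?F \<in> _")
    and distr_random_sum_PiM_pmf:
      "distr (A \<Otimes>\<^sub>M PiM I (\<lambda>j. measure_pmf (Q j))) (count_space UNIV)
         (\<lambda>(t, x). h (r t) + (\<Sum>j\<in>J (r t). g j (x j)))
       = measure_pmf (bind_pmf P (\<lambda>t. map_pmf (\<lambda>s. h t + s) (conv.F (\<lambda>j. map_pmf (g j) (Q j)) (J t))))"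
        (is "_ = measure_pmf (bind_pmf P ?L)")
proof -
  let ?B = "PiM I (\<lambda>j. measure_pmf (Q j))"
  interpret B: product_prob_space "\<lambda>j. measure_pmf (Q j)" I
    by unfold_locales
  have r: "r \<in> A \<rightarrow>\<^sub>M count_space UNIV"
    using A(3) by (rule measurable_count_space_UNIV)
  have S: "(\<lambda>x. h t + (\<Sum>j\<in>J t. g j (x j))) \<in> ?B \<rightarrow>\<^sub>M count_space UNIV" for t
    using measurable_sum_PiM_pmf[OF J, where g = g and Q = Q] by (rule measurable_compose) simp
  have L: "distr ?B (count_space UNIV) (\<lambda>x. h t + (\<Sum>j\<in>J t. g j (x j))) = measure_pmf (?L t)" for t
    unfolding map_pmf_rep_eq
    by (subst distr_sum_PiM_pmf[OF J, symmetric], subst distr_distr[OF _ measurable_sum_PiM_pmf[OF J]])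
       (auto simp: o_def)
  \<comment> \<open>Measurability is glued together over the countably many values of
    \<open>r\<close>.\<close>
  have "(\<lambda>w. (\<lambda>t w. h t + (\<Sum>j\<in>J t. g j (snd w j))) (r (fst w)) w) \<in> A \<Otimes>\<^sub>M ?B \<rightarrow>\<^sub>M count_space UNIV"
    by (rule measurable_compose_countable'[OF _ _ A(2)])
       (auto intro!: measurable_compose[OF measurable_snd S] measurable_compose[OF measurable_fst A(3)])
  then show F: "?F \<in> A \<Otimes>\<^sub>M ?B \<rightarrow>\<^sub>M count_space UNIV"
    by (simp add: case_prod_beta')
  show "distr (A \<Otimes>\<^sub>M ?B) (count_space UNIV) ?F = measure_pmf (bind_pmf P ?L)"
  proof (rule measure_eqI)
    fix X :: "'c set"
    have "emeasure (distr (A \<Otimes>\<^sub>M ?B) (count_space UNIV) ?F) X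
        = emeasure (A \<Otimes>\<^sub>M ?B) (?F -` X \<inter> space (A \<Otimes>\<^sub>M ?B))"
      by (rule emeasure_distr[OF F]) simp
    also have "\<dots> = (\<integral>\<^sup>+t. emeasure ?B (Pair t -` (?F -` X \<inter> space (A \<Otimes>\<^sub>M ?B))) \<partial>A)"
      using measurable_sets[OF F, of X] by (intro B.emeasure_pair_measure_alt) simp
    also have "\<dots> = (\<integral>\<^sup>+t. emeasure (measure_pmf (?L (r t))) X \<partial>A)"
      by (intro nn_integral_cong)
         (auto simp: L[symmetric] emeasure_distr[OF S] space_pair_measure intro!: arg_cong[where f = "emeasure ?B"])
    also have "\<dots> = (\<integral>\<^sup>+t. emeasure (measure_pmf (?L t)) X \<partial>distr A (count_space UNIV) r)"
      by (subst nn_integral_distr[OF r]) auto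
    also have "\<dots> = emeasure (measure_pmf (bind_pmf P ?L)) X"
      by (simp add: P emeasure_bind_pmf)
    finally show "emeasure (distr (A \<Otimes>\<^sub>M ?B) (count_space UNIV) ?F) X = emeasure (measure_pmf (bind_pmf P ?L)) X" .
  qed simp
qed

unbundle no vec_syntax and fps_syntax

section \<open>The power series of (1 - x) to the power -r\<close>

definition binom_series :: "real \<Rightarrow> real fps" where
  "binom_series r = Abs_fps (\<lambda>n. pochhammer r n / fact n)"

lemma binom_series_nth: "binom_series r $ n = pochhammer r n / fact n"
  by (simp add: binom_series_def)

lemma binom_series_nth_0 [simp]: "binom_series r $ 0 = 1"
  by (simp add: binom_series_nth)

lemma binom_series_nth_Suc: "real (Suc n) * binom_series r $ Suc n = (r + real n) * binom_series r $ n"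
  by (simp add: binom_series_nth pochhammer_rec' field_simps del: of_nat_Suc)

lemma nth_one_minus_X_deriv:
  "((1 - fps_X) * fps_deriv F) $ n = real (Suc n) * F $ Suc n - real n * F $ n" for F :: "real fps"
  unfolding left_diff_distrib mult_1_left fps_sub_nth fps_X_mult_nth fps_deriv_nth
  by (cases n) simp_all

lemma binom_series_deriv: "(1 - fps_X) * fps_deriv (binom_series r) = fps_const r * binom_series r"
  by (rule fps_ext) (simp only: nth_one_minus_X_deriv binom_series_nth_Suc, simp add: algebra_simps)

text \<open>Comparing coefficients in the differential equation gives a first-order recursion, which
  the constant term starts.\<close>

lemma binom_series_unique:
  assumes "(1 - fps_X) * fps_deriv F = fps_const r * F" "F $ 0 = 1"
  shows "F = binom_series r"
proof (rule fps_ext)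
  fix n
  have rec: "real (Suc m) * F $ Suc m = (r + real m) * F $ m" for m
    using arg_cong[OF assms(1), of "\<lambda>H. H $ m"] unfolding nth_one_minus_X_deriv
    by (simp add: algebra_simps)
  show "F $ n = binom_series r $ n"
  proof (induction n)
    case (Suc n)
    have "real (Suc n) * F $ Suc n = real (Suc n) * binom_series r $ Suc n"
      by (simp only: rec binom_series_nth_Suc Suc)
    then show ?case by simp
  qed (use assms(2) in simp)
qed

lemma binom_series_sums:
  assumes "0 < a" "a < 2"
  shows "(\<lambda>n. binom_series r $ n * (1 - a) ^ n) sums a powr - r"
proof -
  have "(\<lambda>n. (-r gchoose n) * (- (1 - a)) ^ n) sums (1 + - (1 - a)) powr - r"
    using assms by (intro gen_binomial_real) auto
  moreover have "(-r gchoose n) * (- (1 - a)) ^ n = binom_series r $ n * (1 - a) ^ n" for n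
    unfolding gbinomial_pochhammer power_minus[of "1 - a"]
    by (simp add: binom_series_nth flip: power_mult_distrib)
  ultimately show ?thesis by simp
qed

text \<open>The series of \<open>1 - (1 - x) powr \<kappa>\<close>. For
  \<open>0 < \<kappa> < 1\<close> it is the generating function of the Sibuya law, and the truncated
  negative binomial law is its exponential tilt by \<open>(1 - a) ^ l\<close>.\<close>

abbreviation sibuya_series :: "real \<Rightarrow> real fps" where
  "sibuya_series \<kappa> \<equiv> 1 - binom_series (- \<kappa>)"

lemma sibuya_series_deriv:
  "(1 - fps_X) * fps_deriv (sibuya_series \<kappa>) = fps_const \<kappa> * (1 - sibuya_series \<kappa>)"
  using binom_series_deriv[of "- \<kappa>"] by (simp add: algebra_simps flip: fps_const_neg)

lemma sibuya_power_nth_eq_0: "l < n \<Longrightarrow> sibuya_series \<kappa> ^ n $ l = 0"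
  by (rule startsby_zero_power_prefix[rule_format]) simp_all

text \<open>With \<open>W\<close> the inner series, \<open>1 - W\<close> is
  \<open>(1 - x) powr \<kappa>\<close>, whose power \<open>- r / \<kappa>\<close> is
  \<open>(1 - x) powr (- r)\<close>. The differential equation characterising the latter is verified
  by the chain rule.\<close>

lemma binom_series_compose_sibuya:
  assumes "\<kappa> \<noteq> 0"
  shows "binom_series (r / \<kappa>) oo sibuya_series \<kappa> = binom_series r"
proof (rule binom_series_unique)
  let ?F = "binom_series (r / \<kappa>)" and ?W = "sibuya_series \<kappa>"
  have W: "?W $ 0 = 0" by simp
  have "(1 - fps_X) * fps_deriv (?F oo ?W) = (fps_deriv ?F oo ?W) * ((1 - fps_X) * fps_deriv ?W)"
    by (simp only: fps_compose_deriv[OF W] ac_simps)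
  also have "\<dots> = fps_const \<kappa> * ((1 - ?W) * (fps_deriv ?F oo ?W))"
    unfolding sibuya_series_deriv by (simp only: ac_simps)
  also have "(1 - ?W) * (fps_deriv ?F oo ?W) = ((1 - fps_X) * fps_deriv ?F) oo ?W"
    by (simp only: fps_compose_mult_distrib[OF W] fps_compose_sub_distrib fps_compose_1 fps_X_fps_compose_startby0[OF W])
  also have "\<dots> = fps_const (r / \<kappa>) * (?F oo ?W)"
    unfolding binom_series_deriv by (simp only: fps_compose_mult_distrib[OF W] fps_const_compose)
  finally show "(1 - fps_X) * fps_deriv (?F oo ?W) = fps_const r * (?F oo ?W)"
    using assms by (simp flip: mult.assoc)
qed simp

definition step_coeff :: "real \<Rightarrow> real \<Rightarrow> nat \<Rightarrow> nat \<Rightarrow> real" where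
  "step_coeff r \<kappa> n l = (binom_series r * sibuya_series \<kappa> ^ n) $ l"

lemma step_coeff_eq_0: "l < n \<Longrightarrow> step_coeff r \<kappa> n l = 0"
  unfolding step_coeff_def fps_mult_nth
  by (intro sum.neutral ballI) (simp add: sibuya_power_nth_eq_0)

lemma step_coeff_0_0 [simp]: "step_coeff r \<kappa> 0 0 = 1"
  by (simp add: step_coeff_def)

text \<open>Coefficient comparison in the differential equation of \<open>G * W ^ n\<close>. As
  \<open>(1 - x) * W' = \<kappa> * (1 - W)\<close>, differentiating \<open>W ^ n\<close> yields a
  multiple of \<open>W ^ (n - 1) - W ^ n\<close>, hence the term with \<open>n - 1\<close>. At
  \<open>n = 0\<close> the truncated difference is multiplied by zero.\<close>

lemma step_coeff_rec:
  "real (Suc l) * step_coeff r \<kappa> n (Suc l)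
     = (real l - \<kappa> * real n + r) * step_coeff r \<kappa> n l + \<kappa> * real n * step_coeff r \<kappa> (n - 1) l"
proof -
  let ?G = "binom_series r" and ?W = "sibuya_series \<kappa>"
  have W: "(1 - fps_X) * fps_deriv (?W ^ n) = fps_const (\<kappa> * real n) * (?W ^ (n - 1) - ?W ^ n)"
  proof (cases n)
    case (Suc m)
    have "(1 - fps_X) * fps_deriv (?W ^ n) = fps_const (real n) * ?W ^ (n - 1) * ((1 - fps_X) * fps_deriv ?W)"
      unfolding fps_deriv_power by (simp only: ac_simps)
    also have "\<dots> = fps_const (\<kappa> * real n) * (?W ^ (n - 1) * (1 - ?W))"
      unfolding sibuya_series_deriv fps_const_mult[symmetric] by (simp only: ac_simps)
    also have "?W ^ (n - 1) * (1 - ?W) = ?W ^ (n - 1) - ?W ^ n"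
      by (simp only: Suc diff_Suc_1 right_diff_distrib mult_1_right power_Suc2)
    finally show ?thesis .
  qed simp
  have "(1 - fps_X) * fps_deriv (?G * ?W ^ n)
      = (1 - fps_X) * fps_deriv ?G * ?W ^ n + ?G * ((1 - fps_X) * fps_deriv (?W ^ n))"
    by (simp only: fps_deriv_mult distrib_left ac_simps)
  also have "\<dots> = fps_const r * (?G * ?W ^ n) + fps_const (\<kappa> * real n) * (?G * ?W ^ (n - 1) - ?G * ?W ^ n)"
    by (simp only: binom_series_deriv W) (simp only: right_diff_distrib ac_simps)
  finally have "((1 - fps_X) * fps_deriv (?G * ?W ^ n)) $ l
      = r * step_coeff r \<kappa> n l + \<kappa> * real n * (step_coeff r \<kappa> (n - 1) l - step_coeff r \<kappa> n l)"
    by (simp only: fps_add_nth fps_sub_nth fps_mult_left_const_nth step_coeff_def)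
  moreover have "((1 - fps_X) * fps_deriv (?G * ?W ^ n)) $ l
      = real (Suc l) * step_coeff r \<kappa> n (Suc l) - real l * step_coeff r \<kappa> n l"
    by (simp only: nth_one_minus_X_deriv step_coeff_def)
  ultimately show ?thesis
    by (simp add: algebra_simps)
qed

section \<open>Negative binomial and truncated negative binomial laws\<close>

lemma pos_notin_nonpos_Ints: "0 < x \<Longrightarrow> (x :: real) \<notin> \<int>\<^sub>\<le>\<^sub>0"
  by (auto elim!: nonpos_Ints_cases)

lemma p_NB_eq: "0 < r \<Longrightarrow> p_NB r a l = a powr r * (1 - a) ^ l * binom_series r $ l"
  by (simp add: p_NB_def binom_series_nth pochhammer_Gamma pos_notin_nonpos_Ints add.commute mult_ac)

lemma p_TNB_eq:
  assumes "0 < \<kappa>" "\<kappa> < 1"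
  shows "p_TNB \<kappa> a l = 1 / (1 - a powr \<kappa>) * (1 - a) ^ l * sibuya_series \<kappa> $ l"
proof (cases l)
  case (Suc m)
  have "1 - \<kappa> \<notin> \<int>\<^sub>\<le>\<^sub>0"
    using assms by (simp add: pos_notin_nonpos_Ints)
  then have "pochhammer (- \<kappa>) l = - (\<kappa> * Gamma (real l - \<kappa>) / Gamma (1 - \<kappa>))"
    by (simp add: Suc pochhammer_rec pochhammer_Gamma algebra_simps)
  then show ?thesis
    by (simp add: Suc p_TNB_def binom_series_nth mult_ac)
qed (simp add: p_TNB_def)

lemma embed_pmf_nat:
  assumes "\<And>l. 0 \<le> f l" "f sums 1"
  shows pmf_embed_pmf_nat: "pmf (embed_pmf f) l = f (l :: nat)"
    and point_measure_embed_pmf_nat: "point_measure UNIV (\<lambda>l. ennreal (f l)) = measure_pmf (embed_pmf f)"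
proof -
  have "(\<integral>\<^sup>+l. ennreal (f l) \<partial>count_space UNIV) = 1"
    using assms by (simp add: nn_integral_count_space_nat suminf_ennreal2 sums_iff)
  then show *: "pmf (embed_pmf f) l = f l" for l
    using assms by (intro pmf_embed_pmf)
  show "point_measure UNIV (\<lambda>l. ennreal (f l)) = measure_pmf (embed_pmf f)"
    unfolding measure_pmf_eq_density[of "embed_pmf f"] * by (simp add: point_measure_def)
qed

definition NB_pmf :: "real \<Rightarrow> real \<Rightarrow> nat pmf" where
  "NB_pmf r a = embed_pmf (p_NB r a)"

definition TNB_pmf :: "real \<Rightarrow> real \<Rightarrow> nat pmf" where
  "TNB_pmf \<kappa> a = embed_pmf (p_TNB \<kappa> a)"

lemma NB_pmf:
  assumes "0 < r" "0 < a" "a < 1"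
  shows pmf_NB: "pmf (NB_pmf r a) l = a powr r * (1 - a) ^ l * binom_series r $ l"
    and NB_eq_pmf: "NB r a = measure_pmf (NB_pmf r a)"
proof -
  have nonneg: "0 \<le> p_NB r a l" for l
    using assms by (simp add: p_NB_def)
  have "(\<lambda>l. a powr r * (binom_series r $ l * (1 - a) ^ l)) sums (a powr r * a powr - r)"
    using assms by (intro sums_mult binom_series_sums) auto
  then have "(\<lambda>l. p_NB r a l) sums 1"
    using assms by (simp add: p_NB_eq ac_simps flip: powr_add)
  note * = embed_pmf_nat[OF nonneg this]
  show "pmf (NB_pmf r a) l = a powr r * (1 - a) ^ l * binom_series r $ l"
    by (simp only: NB_pmf_def *(1) p_NB_eq[OF assms(1)])
  show "NB r a = measure_pmf (NB_pmf r a)"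
    using *(2) by (simp add: NB_pmf_def NB_def)
qed

lemma powr_less_one_of_less_one:
  assumes "0 < a" "a < 1" "0 < (x::real)"
  shows "a powr x < 1"
  using assms by (simp add: powr_def mult_less_0_iff)

lemma TNB_pmf:
  assumes "0 < \<kappa>" "\<kappa> < 1" "0 < a" "a < 1"
  shows pmf_TNB: "pmf (TNB_pmf \<kappa> a) l = 1 / (1 - a powr \<kappa>) * (1 - a) ^ l * sibuya_series \<kappa> $ l"
    and TNB_eq_pmf: "TNB \<kappa> a = measure_pmf (TNB_pmf \<kappa> a)"
proof -
  have less: "a powr \<kappa> < 1"
    using assms by (simp add: powr_less_one_of_less_one)
  have nonneg: "0 \<le> p_TNB \<kappa> a l" for l
    using assms less by (auto simp: p_TNB_def intro!: mult_nonneg_nonneg divide_nonneg_nonneg)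
  \<comment> \<open>The constant series is the \<open>1\<close> in
    \<open>1 - (1 - x) powr \<kappa>\<close>; at \<open>x = 1 - a\<close> the difference sums to the
    normalising constant \<open>1 - a powr \<kappa>\<close>.\<close>
  have "(\<lambda>l. (1 :: real fps) $ l * (1 - a) ^ l) sums 1"
    using sums_single[of 0 "\<lambda>_. 1 :: real"] by (rule sums_cong[THEN iffD1, rotated]) auto
  from sums_mult[OF sums_diff[OF this binom_series_sums[of a "- \<kappa>"]], of "1 / (1 - a powr \<kappa>)"]
  have "(\<lambda>l. p_TNB \<kappa> a l) sums 1"
    using assms less by (simp add: p_TNB_eq algebra_simps)
  note * = embed_pmf_nat[OF nonneg this]
  show "pmf (TNB_pmf \<kappa> a) l = 1 / (1 - a powr \<kappa>) * (1 - a) ^ l * sibuya_series \<kappa> $ l"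
    by (simp only: TNB_pmf_def *(1) p_TNB_eq[OF assms(1,2)])
  show "TNB \<kappa> a = measure_pmf (TNB_pmf \<kappa> a)"
    using *(2) by (simp add: TNB_pmf_def TNB_def)
qed

lemma pmf_conv_nat: "pmf (conv_pmf p q) l = (\<Sum>j=0..l. pmf p j * pmf q (l - j))" for l :: nat
proof -
  have "pmf (map_pmf ((+) x) q) l = (if x \<le> l then pmf q (l - x) else 0)" for x
  proof (cases "x \<le> l")
    case True
    then have "pmf (map_pmf ((+) x) q) l = pmf (map_pmf ((+) x) q) (x + (l - x))"
      by simp
    also have "\<dots> = pmf q (l - x)"
      by (rule pmf_map_inj') (auto intro!: injI)
    finally show ?thesis using True by simp
  qed (auto simp: pmf_eq_0_set_pmf)
  then have "pmf (conv_pmf p q) l = measure_pmf.expectation p (\<lambda>x. if x \<le> l then pmf q (l - x) else 0)"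
    by (simp add: conv_pmf_def pmf_bind)
  also have "\<dots> = (\<Sum>j=0..l. (if j \<le> l then pmf q (l - j) else 0) * pmf p j)"
    by (rule integral_measure_pmf_real) (auto split: if_splits)
  finally show ?thesis by (simp add: mult.commute)
qed

text \<open>The tilt \<open>c ^ l\<close> is multiplicative in \<open>l\<close>, so it factors out
  of the convolution and leaves a Cauchy product of power series.\<close>

lemma pmf_conv_scaled:
  assumes "\<And>l. pmf p l = \<alpha> * c ^ l * F $ l" "\<And>l. pmf q l = \<beta> * c ^ l * G $ l"
  shows "pmf (conv_pmf p q) l = \<alpha> * \<beta> * c ^ l * (F * G) $ l"
  unfolding pmf_conv_nat fps_mult_nth assms sum_distrib_left
  by (intro sum.cong refl) (auto simp: mult_ac simp flip: power_add)

lemma pmf_conv_pow_TNB: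
  assumes "0 < \<kappa>" "\<kappa> < 1" "0 < a" "a < 1"
  shows "pmf (conv_pow (TNB_pmf \<kappa> a) n) l = (1 / (1 - a powr \<kappa>)) ^ n * (1 - a) ^ l * (sibuya_series \<kappa> ^ n) $ l"
proof (induction n arbitrary: l)
  case 0
  show ?case by (auto simp: indicator_def)
next
  case (Suc n)
  show ?case
    using pmf_conv_scaled[OF pmf_TNB[OF assms] Suc] by simp
qed

text \<open>The alternative \<open>n = 0\<close> serves the top level \<open>k\<close>, where the
  ratio of consecutive \<open>bcoef\<close> values is \<open>- \<delta>\<close> and may lie outside
  the unit interval.\<close>

lemma pmf_conv_NB_TNB:
  assumes "0 < r" "0 < a" "a < 1" "0 < \<kappa> \<and> \<kappa> < 1 \<or> n = 0"
  shows "pmf (conv_pmf (NB_pmf r a) (conv_pow (TNB_pmf \<kappa> a) n)) l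
     = a powr r * ((1 - a) ^ l / (1 - a powr \<kappa>) ^ n) * step_coeff r \<kappa> n l"
proof (cases "n = 0")
  case True
  then show ?thesis by (simp add: pmf_NB assms step_coeff_def)
next
  case False
  with assms have \<kappa>: "0 < \<kappa>" "\<kappa> < 1" by auto
  show ?thesis
    by (subst pmf_conv_scaled[OF pmf_NB[OF assms(1-3)] pmf_conv_pow_TNB[OF \<kappa> assms(2,3)]])
       (simp add: step_coeff_def field_simps)
qed

text \<open>A random sum composes generating functions, so this is
  \<open>binom_series_compose_sibuya\<close> in probabilistic form; the factors
  \<open>(1 - a powr \<kappa>) ^ n\<close> of the two laws cancel.\<close>

lemma random_sum_NB_TNB:
  assumes "0 < r" "0 < a" "a < 1" "0 < \<kappa>" "\<kappa> < 1"
  shows "random_sum (NB_pmf (r / \<kappa>) (a powr \<kappa>)) (TNB_pmf \<kappa> a) (\<lambda>_. 0) = NB_pmf r a"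
proof (rule pmf_eqI)
  fix l
  have less: "a powr \<kappa> < 1"
    using assms by (simp add: powr_less_one_of_less_one)
  have "pmf (random_sum (NB_pmf (r / \<kappa>) (a powr \<kappa>)) (TNB_pmf \<kappa> a) (\<lambda>_. 0)) l
      = measure_pmf.expectation (NB_pmf (r / \<kappa>) (a powr \<kappa>)) (\<lambda>n. pmf (conv_pow (TNB_pmf \<kappa> a) n) l)"
    by (simp add: random_sum_def pmf_bind)
  \<comment> \<open>The expectation is a finite sum, because
    \<open>sibuya_series \<kappa> ^ n\<close> has no terms below degree \<open>n\<close>.\<close>
  also have "\<dots> = (\<Sum>n=0..l. pmf (conv_pow (TNB_pmf \<kappa> a) n) l * pmf (NB_pmf (r / \<kappa>) (a powr \<kappa>)) n)"
  proof (rule integral_measure_pmf_real)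
    fix n assume "pmf (conv_pow (TNB_pmf \<kappa> a) n) l \<noteq> 0"
    then have "sibuya_series \<kappa> ^ n $ l \<noteq> 0"
      using assms by (auto simp: pmf_conv_pow_TNB)
    then show "n \<in> {0..l}"
      using sibuya_power_nth_eq_0[of l n \<kappa>] by force
  qed simp
  also have "\<dots> = (\<Sum>n=0..l. a powr r * (1 - a) ^ l * (binom_series (r / \<kappa>) $ n * (sibuya_series \<kappa> ^ n) $ l))"
    using assms less
    by (intro sum.cong refl)
       (simp add: pmf_conv_pow_TNB pmf_NB powr_powr field_simps)
  also have "\<dots> = a powr r * (1 - a) ^ l * (binom_series (r / \<kappa>) oo sibuya_series \<kappa>) $ l"
    by (simp add: fps_compose_nth sum_distrib_left)
  also have "\<dots> = pmf (NB_pmf r a) l"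
    using assms by (simp add: binom_series_compose_sibuya pmf_NB)
  finally show "pmf (random_sum (NB_pmf (r / \<kappa>) (a powr \<kappa>)) (TNB_pmf \<kappa> a) (\<lambda>_. 0)) l = pmf (NB_pmf r a) l" .
qed

section \<open>The solution of the recursion\<close>

text \<open>Under \<open>x = 1 / z\<close> this is the beta integral with parameters
  \<open>c\<close> and \<open>n + 1\<close>. Expanding one factor \<open>1 - 1 / z\<close> gives the
  difference of the integrals for \<open>c\<close> and \<open>c + 1\<close>, so the induction keeps
  \<open>c\<close> arbitrary.\<close>

lemma has_bochner_integral_powr_beta:
  fixes c :: real
  assumes "0 < c"
  shows "has_bochner_integral lborel (\<lambda>z. indicator {1..} z * (z powr (- (1 + c)) * (1 - 1 / z) ^ n))
    (fact n / pochhammer c (Suc n))"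
  using assms
proof (induction n arbitrary: c)
  case 0
  have "(\<integral>\<^sup>+z. ennreal (z powr (- (1 + c))) * indicator {1..} z \<partial>lborel) = ennreal (0 - (- (1 powr - c) / c))"
  proof (rule nn_integral_FTC_atLeast)
    show "((\<lambda>z. - (z powr - c) / c) has_real_derivative z powr - (1 + c)) (at z)" if "1 \<le> z" for z
      using that 0 by (auto intro!: derivative_eq_intros simp: powr_diff powr_minus divide_simps powr_add power2_eq_square)
    show "((\<lambda>z. - (z powr - c) / c) \<longlongrightarrow> 0) at_top"
      using 0 by real_asymp
  qed auto
  then show ?case
    by (intro has_bochner_integral_nn_integral)
       (auto simp: mult.commute ennreal_mult' ennreal_indicator 0 less_imp_le)
next
  case (Suc n)
  let ?f = "\<lambda>c n z. indicator {1..} z * (z powr (- (1 + c)) * (1 - 1 / z) ^ n) :: real"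
  have pos: "0 < pochhammer c (Suc n)" "0 < pochhammer (c + 1) (Suc n)"
    using Suc.prems by (auto intro!: pochhammer_pos)
  have "has_bochner_integral lborel (\<lambda>z. ?f c n z - ?f (c + 1) n z)
      (fact n / pochhammer c (Suc n) - fact n / pochhammer (c + 1) (Suc n))"
    using Suc.prems by (intro has_bochner_integral_diff Suc.IH) auto
  moreover have "?f c n z - ?f (c + 1) n z = ?f c (Suc n) z" for z
    by (auto simp: indicator_def powr_diff powr_minus powr_add divide_simps) (simp_all add: algebra_simps power2_eq_square)
  moreover have "fact n / pochhammer c (Suc n) - fact n / pochhammer (c + 1) (Suc n)
      = fact (Suc n) / pochhammer c (Suc (Suc n))"
  proof -
    have "pochhammer c (Suc (Suc n)) = c * pochhammer (c + 1) (Suc n)"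
      "pochhammer c (Suc (Suc n)) = (c + real (Suc n)) * pochhammer c (Suc n)"
      by (rule pochhammer_rec, rule pochhammer_rec')
    then have "1 / pochhammer (c + 1) (Suc n) = c / pochhammer c (Suc (Suc n))"
      "1 / pochhammer c (Suc n) = (c + real (Suc n)) / pochhammer c (Suc (Suc n))"
      using pos Suc.prems by (auto simp: field_simps)
    then have "fact n * (1 / pochhammer c (Suc n) - 1 / pochhammer (c + 1) (Suc n))
        = fact n * real (Suc n) / pochhammer c (Suc (Suc n))"
      by (simp add: diff_divide_distrib[symmetric])
    then show ?thesis
      by (simp add: right_diff_distrib mult.commute)
  qed
  ultimately show ?case by simp
qed

section \<open>Arithmetic of the constants \<open>bcoef\<close> and \<open>tau\<close>\<close>

lemma bcoef_eq: "bcoef k \<delta> m = 1 + (real k - real m) * (1 + \<delta>)"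
  by (simp add: bcoef_def algebra_simps)

lemma bcoef_pos: "\<delta> > -1 \<Longrightarrow> m \<le> k \<Longrightarrow> 0 < bcoef k \<delta> m"
  unfolding bcoef_eq by (intro add_pos_nonneg mult_nonneg_nonneg) auto

lemma bcoef_Suc: "bcoef k \<delta> (Suc m) = bcoef k \<delta> m - (1 + \<delta>)"
  by (simp add: bcoef_eq algebra_simps)

lemma bcoef_self [simp]: "bcoef k \<delta> k = 1"
  by (simp add: bcoef_eq)

lemma tau_eq: "tau k \<delta> = bcoef k \<delta> 0 + (1 + \<delta>)"
  by (simp add: tau_def bcoef_eq algebra_simps)

lemma tau_pos: "\<delta> > -1 \<Longrightarrow> 0 < tau k \<delta>"
  using bcoef_pos[of \<delta> 0 k] by (simp add: tau_eq)

section \<open>The coefficients of the single levels and their product along the chain\<close>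

definition level_coeff :: "nat \<Rightarrow> real \<Rightarrow> nat \<Rightarrow> nat \<Rightarrow> nat \<Rightarrow> real" where
  "level_coeff k \<delta> j = step_coeff ((1 + \<delta>) / bcoef k \<delta> j) (bcoef k \<delta> (Suc j) / bcoef k \<delta> j)"

text \<open>This is \<open>step_coeff_rec\<close> cleared of denominators and shifted by one. For
  \<open>l = 0\<close> the assumption \<open>n \<le> l\<close> forces \<open>n = 0\<close>, so the
  last term vanishes as well.\<close>

lemma level_coeff_rec:
  assumes "\<delta> > -1" "j \<le> k" "n \<le> l"
  shows "bcoef k \<delta> j * real l * level_coeff k \<delta> j n l =
    (if l = 0 then 0 else
      (bcoef k \<delta> j * (real l - 1) - bcoef k \<delta> (Suc j) * real n + (1 + \<delta>)) * level_coeff k \<delta> j n (l - 1))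
    + bcoef k \<delta> (Suc j) * real n * level_coeff k \<delta> j (n - 1) (l - 1)"
proof (cases l)
  case (Suc m)
  have b: "bcoef k \<delta> j \<noteq> 0"
    using bcoef_pos[of \<delta> j k] assms by simp
  have "bcoef k \<delta> j * (real l * level_coeff k \<delta> j n l) =
    bcoef k \<delta> j * ((real m - bcoef k \<delta> (Suc j) / bcoef k \<delta> j * real n + (1 + \<delta>) / bcoef k \<delta> j)
       * level_coeff k \<delta> j n m
      + bcoef k \<delta> (Suc j) / bcoef k \<delta> j * real n * level_coeff k \<delta> j (n - 1) m)"
    unfolding level_coeff_def Suc step_coeff_rec by (rule refl)
  also have "\<dots> = (bcoef k \<delta> j * real m - bcoef k \<delta> (Suc j) * real n + (1 + \<delta>)) * level_coeff k \<delta> j n m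
    + bcoef k \<delta> (Suc j) * real n * level_coeff k \<delta> j (n - 1) m"
    using b by (simp add: field_simps)
  finally show ?thesis
    by (simp add: Suc mult.assoc)
qed (use assms in simp)

definition chain_coeff :: "nat \<Rightarrow> real \<Rightarrow> (nat \<Rightarrow> nat) \<Rightarrow> real" where
  "chain_coeff k \<delta> v = (\<Prod>j\<le>k. level_coeff k \<delta> j (v (Suc j)) (v j))"

text \<open>Counterpart of \<open>lower (Suc m)\<close>: the bound \<open>j \<le> m\<close> lowers
  \<open>m + 1\<close> coordinates.\<close>

definition lower_vec :: "nat \<Rightarrow> (nat \<Rightarrow> nat) \<Rightarrow> (nat \<Rightarrow> nat)" where
  "lower_vec m v = (\<lambda>j. if j \<le> m then v j - 1 else v j)"

text \<open>The level recursions are chained from level 0 upwards. At each level, lowering either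
  stops, which yields the summand \<open>m\<close>, or lowers both arguments and hands a factor
  \<open>v (Suc m)\<close> to the next level. It must stop by level \<open>k\<close>, as
  \<open>v (Suc k) = 0\<close>.\<close>

lemma chain_coeff_rec:
  assumes "\<delta> > -1" "v (Suc k) = 0" "\<And>j. j \<le> k \<Longrightarrow> v (Suc j) \<le> v j"
  shows "bcoef k \<delta> 0 * real (v 0) * chain_coeff k \<delta> v =
    (\<Sum>m\<le>k. if v m = 0 then 0 else
      (bcoef k \<delta> m * (real (v m) - 1) - bcoef k \<delta> (Suc m) * real (v (Suc m)) + (1 + \<delta>))
        * chain_coeff k \<delta> (lower_vec m v))"
proof -
  let ?b = "bcoef k \<delta>" and ?c = "level_coeff k \<delta>"
  let ?t = "\<lambda>m. if v m = 0 then 0 else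
      (?b m * (real (v m) - 1) - ?b (Suc m) * real (v (Suc m)) + (1 + \<delta>)) * chain_coeff k \<delta> (lower_vec m v)"
  let ?L = "\<lambda>n. \<Prod>j<n. ?c j (v (Suc j) - 1) (v j - 1)"
  let ?R = "\<lambda>n. \<Prod>j\<in>{n..k}. ?c j (v (Suc j)) (v j)"
  \<comment> \<open>Invariant after \<open>n\<close> levels: the terms stopped so far, plus one term
    in which the levels below \<open>n\<close> are lowered and level \<open>n\<close> still carries
    its factor.\<close>
  have "?b 0 * real (v 0) * chain_coeff k \<delta> v = (\<Sum>m<n. ?t m) + ?b n * real (v n) * ?L n * ?R n"
    if "n \<le> Suc k" for n
    using that
  proof (induction n)
    case 0
    show ?case by (simp add: chain_coeff_def atMost_atLeast0)
  next
    case (Suc n)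
    then have n: "n \<le> k" by simp
    have lower: "chain_coeff k \<delta> (lower_vec n v) = ?L n * ?c n (v (Suc n)) (v n - 1) * ?R (Suc n)"
    proof -
      have "chain_coeff k \<delta> (lower_vec n v) = (\<Prod>j\<in>{..<n} \<union> insert n {Suc n..k}. ?c j (lower_vec n v (Suc j)) (lower_vec n v j))"
        unfolding chain_coeff_def using n by (intro prod.cong) auto
      also have "\<dots> = (\<Prod>j<n. ?c j (lower_vec n v (Suc j)) (lower_vec n v j))
          * (\<Prod>j\<in>insert n {Suc n..k}. ?c j (lower_vec n v (Suc j)) (lower_vec n v j))"
        by (intro prod.union_disjoint) auto
      also have "(\<Prod>j<n. ?c j (lower_vec n v (Suc j)) (lower_vec n v j)) = ?L n"
        by (intro prod.cong) (auto simp: lower_vec_def)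
      also have "(\<Prod>j\<in>insert n {Suc n..k}. ?c j (lower_vec n v (Suc j)) (lower_vec n v j))
          = ?c n (v (Suc n)) (v n - 1) * ?R (Suc n)"
        by (subst prod.insert) (auto simp: lower_vec_def intro!: prod.cong)
      finally show ?thesis by simp
    qed
    have "?R n = ?c n (v (Suc n)) (v n) * ?R (Suc n)"
      using n by (rule prod.atLeast_Suc_atMost)
    then have "?b n * real (v n) * ?L n * ?R n = (?b n * real (v n) * ?c n (v (Suc n)) (v n)) * (?L n * ?R (Suc n))"
      by simp
    also have "\<dots> = ?t n + ?b (Suc n) * real (v (Suc n)) * ?L (Suc n) * ?R (Suc n)"
      unfolding level_coeff_rec[OF assms(1) n assms(3)[OF n]] lower
      by (simp add: algebra_simps)
    finally show ?case
      using Suc by simp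
  qed
  from this[of "Suc k"] show ?thesis
    using assms(2) by (simp add: lessThan_Suc_atMost)
qed

text \<open>Coordinates relative to the minimal admissible index \<open>(k + 1, \<dots>, 1)\<close>;
  these are the values \<open>Y_j\<close>. The zero beyond \<open>k\<close> supplies the boundary
  value of the chain.\<close>

definition excess :: "nat \<Rightarrow> nat list \<Rightarrow> (nat \<Rightarrow> nat)" where
  "excess k i = (\<lambda>j. if j \<le> k then i ! j - (k - j + 1) else 0)"

lemma admissible_nth_ge: "admissible k i \<Longrightarrow> j \<le> k \<Longrightarrow> k - j + 1 \<le> i ! j"
proof (induction "k - j" arbitrary: j)
  case (Suc n)
  then have "k - Suc j + 1 \<le> i ! Suc j" by simp
  moreover have "i ! Suc j < i ! j"
    using Suc by (auto simp: admissible_def)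
  ultimately show ?case
    using Suc.hyps by linarith
qed (auto simp: admissible_def)

lemma admissible_nth_eq: "admissible k i \<Longrightarrow> j \<le> k \<Longrightarrow> i ! j = excess k i j + (k - j + 1)"
  using admissible_nth_ge[of k i j] by (simp add: excess_def)

lemma excess_Suc_le:
  assumes "admissible k i" "j \<le> k"
  shows "excess k i (Suc j) \<le> excess k i j"
proof (cases "j < k")
  case True
  then have "i ! Suc j < i ! j"
    using assms by (simp add: admissible_def)
  with True show ?thesis
    using admissible_nth_eq[OF assms] admissible_nth_eq[OF assms(1), of "Suc j"] by simp
qed (use assms in \<open>simp add: excess_def\<close>)

lemma excess_le:
  assumes "admissible k i" "j \<le> m" "m \<le> k"
  shows "excess k i m \<le> excess k i j"
  using assms(2,3)
proof (induction m rule: dec_induct)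
  case (step n)
  then show ?case
    using excess_Suc_le[OF assms(1), of n] by simp
qed simp

text \<open>If strict decrease fails at \<open>m\<close>, the excess increases from \<open>m\<close>
  to \<open>m + 1\<close>, and the level coefficient there is zero. So the product formula respects
  the convention that the mass vanishes off admissible indices.\<close>

lemma chain_coeff_excess_eq_0:
  assumes "length i = Suc k" "\<And>j. j \<le> k \<Longrightarrow> k - j + 1 \<le> i ! j" "\<not> admissible k i"
  shows "chain_coeff k \<delta> (excess k i) = 0"
proof -
  from assms obtain m where m: "m < k" "i ! m \<le> i ! Suc m"
    unfolding admissible_def using assms(2)[of k] by (auto simp: not_less)
  with assms(2)[of m] have "excess k i m < excess k i (Suc m)"
    by (auto simp: excess_def)
  then have "level_coeff k \<delta> m (excess k i (Suc m)) (excess k i m) = 0"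
    unfolding level_coeff_def by (rule step_coeff_eq_0)
  with m show ?thesis
    unfolding chain_coeff_def by (intro prod_zero) auto
qed

section \<open>The explicit solution and the uniqueness of solutions\<close>

lemma length_lower: "length (lower n i) = length i"
  by (simp add: lower_def)

lemma nth_lower: "j < length i \<Longrightarrow> lower n i ! j = (if j < n then i ! j - 1 else i ! j)"
  by (auto simp: lower_def nth_append min_def)

lemma excess_lower: "length i = Suc k \<Longrightarrow> excess k (lower (Suc m) i) = lower_vec m (excess k i)"
  by (rule ext) (auto simp: excess_def lower_vec_def nth_lower)

text \<open>Parameter of the beta integral: the density of \<open>Z\<close> times the
  \<open>k + 1\<close> factors \<open>z powr (- (1 + \<delta>) / b_0)\<close> is proportional to
  \<open>z powr (- (1 + decay))\<close>.\<close>

definition decay :: "nat \<Rightarrow> real \<Rightarrow> real" where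
  "decay k \<delta> = (tau k \<delta> + (1 + \<delta>) * real (Suc k)) / bcoef k \<delta> 0"

definition degree_pmf :: "nat \<Rightarrow> real \<Rightarrow> nat list \<Rightarrow> real" where
  "degree_pmf k \<delta> i = (if admissible k i
     then tau k \<delta> / bcoef k \<delta> 0 * (fact (excess k i 0) / pochhammer (decay k \<delta>) (Suc (excess k i 0)))
        * chain_coeff k \<delta> (excess k i)
     else 0)"

text \<open>A zero excess at \<open>m\<close> makes the lowered entry too small to be admissible.
  Otherwise the lower bounds survive, and if strict decrease fails, both sides are zero by
  \<open>chain_coeff_excess_eq_0\<close>.\<close>

lemma degree_pmf_lower:
  assumes "admissible k i" "m \<le> k"
  shows "degree_pmf k \<delta> (lower (Suc m) i) = (if excess k i m = 0 then 0 else
     tau k \<delta> / bcoef k \<delta> 0 * (fact (excess k i 0 - 1) / pochhammer (decay k \<delta>) (Suc (excess k i 0 - 1)))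
        * chain_coeff k \<delta> (lower_vec m (excess k i)))"
proof -
  have len: "length i = Suc k"
    using assms by (simp add: admissible_def)
  show ?thesis
  proof (cases "excess k i m = 0")
    case True
    have "\<not> admissible k (lower (Suc m) i)"
      using admissible_nth_ge[of k "lower (Suc m) i" m] admissible_nth_eq[OF assms] True assms(2)
      by (auto simp: nth_lower len)
    with True show ?thesis by (simp add: degree_pmf_def)
  next
    case False
    have "k - j + 1 \<le> lower (Suc m) i ! j" if "j \<le> k" for j
      using that False excess_le[OF assms(1) _ assms(2), of j] admissible_nth_eq[OF assms(1) that]
      by (auto simp: nth_lower len)
    then have "chain_coeff k \<delta> (lower_vec m (excess k i)) = 0" if "\<not> admissible k (lower (Suc m) i)"
      using chain_coeff_excess_eq_0[OF _ _ that, of \<delta>] by (simp add: length_lower len excess_lower)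
    with False show ?thesis
      by (auto simp: degree_pmf_def excess_lower len lower_vec_def)
  qed
qed

text \<open>Multiplication by \<open>tau\<close> and passage to the excess give all lowered terms
  one common form, matching \<open>chain_coeff_rec\<close>.\<close>

lemma degree_recursion_iff:
  assumes "\<delta> > -1"
  shows "degree_recursion k \<delta> p \<longleftrightarrow>
    (\<forall>i. \<not> admissible k i \<longrightarrow> p i = 0) \<and>
    (\<forall>i. admissible k i \<longrightarrow>
      (tau k \<delta> + bcoef k \<delta> 0 * real (excess k i 0) + (1 + \<delta>) * real (Suc k)) * p i =
        (\<Sum>m\<le>k. (bcoef k \<delta> m * (real (excess k i m) - 1) - bcoef k \<delta> (Suc m) * real (excess k i (Suc m)) + (1 + \<delta>))
          * p (lower (Suc m) i))
        + (if excess k i 0 = 0 then tau k \<delta> else 0))"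
proof -
  let ?b = "bcoef k \<delta>" and ?\<tau> = "tau k \<delta>"
  have "p i = (real (i ! k) - 1 + \<delta>) / ?\<tau> * p (lower (Suc k) i)
      + (\<Sum>m<k. ((real (i ! m) - 1 - real k + real m) * ?b m
                 - (real (i ! Suc m) - real k + real m + 1) * ?b (Suc m)) / ?\<tau> * p (lower (Suc m) i))
      - ((real (i ! 0) - real k) * ?b 0 + \<delta>) / ?\<tau> * p i
      + (if \<forall>l\<le>k. i ! l = k - l + 1 then 1 else 0)
    \<longleftrightarrow> (?\<tau> + ?b 0 * real (excess k i 0) + (1 + \<delta>) * real (Suc k)) * p i =
        (\<Sum>m\<le>k. (?b m * (real (excess k i m) - 1) - ?b (Suc m) * real (excess k i (Suc m)) + (1 + \<delta>))
          * p (lower (Suc m) i)) + (if excess k i 0 = 0 then ?\<tau> else 0)"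
    if i: "admissible k i" for i
  proof -
    let ?v = "excess k i"
    have nth: "real (i ! j) = real (?v j) + real k - real j + 1" if "j \<le> k" for j
      using admissible_nth_eq[OF i that] that by simp
    have vk: "?v (Suc k) = 0" by (simp add: excess_def)
    have sum: "?\<tau> * (\<Sum>m<k. ((real (i ! m) - 1 - real k + real m) * ?b m
                 - (real (i ! Suc m) - real k + real m + 1) * ?b (Suc m)) / ?\<tau> * p (lower (Suc m) i))
      = (\<Sum>m<k. (?b m * (real (?v m) - 1) - ?b (Suc m) * real (?v (Suc m)) + (1 + \<delta>)) * p (lower (Suc m) i))"
      unfolding sum_distrib_left
    proof (intro sum.cong refl)
      fix m assume "m \<in> {..<k}"
      then have "(real (i ! m) - 1 - real k + real m) * ?b m - (real (i ! Suc m) - real k + real m + 1) * ?b (Suc m)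
          = ?b m * (real (?v m) - 1) - ?b (Suc m) * real (?v (Suc m)) + (1 + \<delta>)"
        by (simp add: nth bcoef_Suc algebra_simps)
      then show "?\<tau> * (((real (i ! m) - 1 - real k + real m) * ?b m
            - (real (i ! Suc m) - real k + real m + 1) * ?b (Suc m)) / ?\<tau> * p (lower (Suc m) i))
          = (?b m * (real (?v m) - 1) - ?b (Suc m) * real (?v (Suc m)) + (1 + \<delta>)) * p (lower (Suc m) i)"
        using tau_pos[OF assms, of k] by simp
    qed
    \<comment> \<open>The excess is nonincreasing in its position, so it vanishes throughout once
      its first entry does.\<close>
    have init: "(\<forall>l\<le>k. i ! l = k - l + 1) \<longleftrightarrow> ?v 0 = 0"
      using excess_le[OF i, of 0] by (auto simp: admissible_nth_eq[OF i])
    have "x = A / ?\<tau> * X + S - B / ?\<tau> * x + e \<longleftrightarrow> (?\<tau> + B) * x = ?\<tau> * S + A * X + ?\<tau> * e" for x A X S B e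
    proof -
      have "x = A / ?\<tau> * X + S - B / ?\<tau> * x + e \<longleftrightarrow> ?\<tau> * x = ?\<tau> * (A / ?\<tau> * X + S - B / ?\<tau> * x + e)"
        using tau_pos[OF assms, of k] by simp
      also have "?\<tau> * (A / ?\<tau> * X + S - B / ?\<tau> * x + e) = A * X + ?\<tau> * S - B * x + ?\<tau> * e"
        using tau_pos[OF assms, of k] by (simp add: ring_distribs)
      finally show ?thesis by (auto simp: ring_distribs)
    qed
    note this[of "p i"]
    \<comment> \<open>The separate term with \<open>lower (Suc k) i\<close> becomes the summand
      \<open>m = k\<close>, because \<open>b_k = 1\<close> and the excess at \<open>k + 1\<close> is
      zero.\<close>
    then show ?thesis
      by (simp only: sum init lessThan_Suc_atMost[symmetric] sum.lessThan_Suc)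
         (simp add: nth vk bcoef_eq algebra_simps)
  qed
  then show ?thesis
    unfolding degree_recursion_def by blast
qed

text \<open>Every lowered index has a smaller first entry, and the factor in front of
  \<open>p i\<close> is positive.\<close>

lemma degree_recursion_unique:
  assumes "\<delta> > -1" "degree_recursion k \<delta> p" "degree_recursion k \<delta> q"
  shows "p i = q i"
proof (induction "i ! 0" arbitrary: i rule: less_induct)
  case less
  note p = assms(2)[unfolded degree_recursion_iff[OF assms(1)]] 
    and q = assms(3)[unfolded degree_recursion_iff[OF assms(1)]]
  show ?case
  proof (cases "admissible k i")
    case True
    have "lower (Suc m) i ! 0 < i ! 0" for m
      using True admissible_nth_ge[OF True, of 0] by (subst nth_lower) (auto simp: admissible_def)
    then have eq: "p (lower (Suc m) i) = q (lower (Suc m) i)" for m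
      by (rule less)
    have "0 < tau k \<delta> + bcoef k \<delta> 0 * real (excess k i 0) + (1 + \<delta>) * real (Suc k)"
      using tau_pos[of \<delta> k] bcoef_pos[of \<delta> 0 k] assms(1)
      by (intro add_pos_nonneg) auto
    moreover have "(tau k \<delta> + bcoef k \<delta> 0 * real (excess k i 0) + (1 + \<delta>) * real (Suc k)) * p i
        = (tau k \<delta> + bcoef k \<delta> 0 * real (excess k i 0) + (1 + \<delta>) * real (Suc k)) * q i"
      using p q True by (simp only: eq)
    ultimately show ?thesis by simp
  qed (use p q in simp)
qed

lemma fact_over_pochhammer_rec:
  fixes c :: real
  assumes "0 < c"
  shows "(real n + c) * (fact n / pochhammer c (Suc n)) =
    (if n = 0 then 1 else real n * (fact (n - 1) / pochhammer c (Suc (n - 1))))"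
proof (cases n)
  case (Suc m)
  have "(real n + c) * (fact n / pochhammer c (Suc n)) = fact n / pochhammer c n"
    using assms unfolding pochhammer_rec'[of c n] by (simp add: add.commute)
  then show ?thesis
    by (simp add: Suc del: of_nat_Suc)
qed (use assms in simp)

lemma decay_pos: "\<delta> > -1 \<Longrightarrow> 0 < decay k \<delta>"
  unfolding decay_def using tau_pos[of \<delta> k] bcoef_pos[of \<delta> 0 k]
  by (intro divide_pos_pos add_pos_nonneg) auto

text \<open>The left factor equals \<open>b_0 * (v_0 + decay)\<close>, with \<open>v_0\<close> the
  first excess. The beta factor absorbs \<open>v_0 + decay\<close> and moves from \<open>v_0\<close>
  to \<open>v_0 - 1\<close>; what remains is \<open>chain_coeff_rec\<close>, or the inhomogeneous
  term when \<open>v_0 = 0\<close>.\<close>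

lemma degree_recursion_degree_pmf:
  assumes "\<delta> > -1"
  shows "degree_recursion k \<delta> (degree_pmf k \<delta>)"
  unfolding degree_recursion_iff[OF assms]
proof (intro conjI allI impI)
  fix i assume i: "admissible k i"
  let ?b = "bcoef k \<delta>" and ?v = "excess k i" and ?c = "decay k \<delta>"
  let ?I = "\<lambda>n. fact n / pochhammer ?c (Suc n) :: real"
  let ?s = "tau k \<delta> / ?b 0"
  have b: "?b 0 > 0"
    using assms by (simp add: bcoef_pos)
  have "(\<Sum>m\<le>k. (?b m * (real (?v m) - 1) - ?b (Suc m) * real (?v (Suc m)) + (1 + \<delta>)) * degree_pmf k \<delta> (lower (Suc m) i))
     = ?s * ?I (?v 0 - 1) * (\<Sum>m\<le>k. if ?v m = 0 then 0 else
      (?b m * (real (?v m) - 1) - ?b (Suc m) * real (?v (Suc m)) + (1 + \<delta>)) * chain_coeff k \<delta> (lower_vec m ?v))"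
    unfolding sum_distrib_left by (intro sum.cong refl) (simp add: degree_pmf_lower[OF i])
  also have "\<dots> = ?s * ?I (?v 0 - 1) * (?b 0 * real (?v 0) * chain_coeff k \<delta> ?v)"
    by (subst chain_coeff_rec[OF assms]) (auto simp: excess_Suc_le[OF i], simp add: excess_def)
  finally have sum: "(\<Sum>m\<le>k. (?b m * (real (?v m) - 1) - ?b (Suc m) * real (?v (Suc m)) + (1 + \<delta>)) * degree_pmf k \<delta> (lower (Suc m) i))
     = ?s * ?I (?v 0 - 1) * (?b 0 * real (?v 0) * chain_coeff k \<delta> ?v)" .
  have "(tau k \<delta> + ?b 0 * real (?v 0) + (1 + \<delta>) * real (Suc k)) * degree_pmf k \<delta> i
      = ?b 0 * (real (?v 0) + ?c) * degree_pmf k \<delta> i"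
    using b by (simp add: decay_def field_simps)
  also have "\<dots> = ?b 0 * ?s * ((real (?v 0) + ?c) * ?I (?v 0)) * chain_coeff k \<delta> ?v"
    using i by (simp only: degree_pmf_def if_True ac_simps)
  also have "\<dots> = ?s * ?I (?v 0 - 1) * (?b 0 * real (?v 0) * chain_coeff k \<delta> ?v) + (if ?v 0 = 0 then tau k \<delta> else 0)"
  proof (cases "?v 0 = 0")
    case True
    then have "?v j = 0" for j
      using excess_le[OF i, of 0 j] by (cases "j \<le> k") (auto simp: excess_def)
    then have "chain_coeff k \<delta> ?v = 1"
      by (simp add: chain_coeff_def level_coeff_def)
    with True b show ?thesis
      unfolding fact_over_pochhammer_rec[OF decay_pos[OF assms]] by simp
  next
    case False
    then show ?thesis
      unfolding fact_over_pochhammer_rec[OF decay_pos[OF assms]] by simp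
  qed
  finally show "(tau k \<delta> + ?b 0 * real (?v 0) + (1 + \<delta>) * real (Suc k)) * degree_pmf k \<delta> i =
    (\<Sum>m\<le>k. (?b m * (real (?v m) - 1) - ?b (Suc m) * real (?v (Suc m)) + (1 + \<delta>)) * degree_pmf k \<delta> (lower (Suc m) i))
     + (if ?v 0 = 0 then tau k \<delta> else 0)"
    unfolding sum .
qed (simp add: degree_pmf_def)

section \<open>The law of the construction given Z = z\<close>

text \<open>Drawing all parameters at once and then convolving agrees with mixing each factor
  separately, by independence.\<close>

lemma bind_Pi_pmf_conv:
  assumes "finite J"
  shows "bind_pmf (Pi_pmf J d P) (\<lambda>t. conv.F (\<lambda>m. K m (t m)) J) = conv.F (\<lambda>m. bind_pmf (P m) (K m)) J"
  using assms
proof (induction J rule: finite_induct)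
  case (insert j J)
  have "bind_pmf (Pi_pmf (insert j J) d P) (\<lambda>t. conv.F (\<lambda>m. K m (t m)) (insert j J))
      = bind_pmf (P j) (\<lambda>y. bind_pmf (Pi_pmf J d P) (\<lambda>f. conv_pmf (K j y) (conv.F (\<lambda>m. K m ((f(j := y)) m)) J)))"
    using insert.hyps by (simp add: Pi_pmf_insert' bind_assoc_pmf bind_return_pmf)
  also have "\<dots> = bind_pmf (P j) (\<lambda>y. bind_pmf (Pi_pmf J d P) (\<lambda>f. conv_pmf (K j y) (conv.F (\<lambda>m. K m (f m)) J)))"
    using insert.hyps by (intro bind_pmf_cong refl arg_cong2[where f = conv_pmf] conv.cong) auto
  also have "\<dots> = conv_pmf (bind_pmf (P j) (K j)) (bind_pmf (Pi_pmf J d P) (\<lambda>f. conv.F (\<lambda>m. K m (f m)) J))"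
    unfolding conv_pmf_def map_bind_pmf bind_assoc_pmf
    by (subst bind_commute_pmf) (rule refl)
  finally show ?case
    using insert by simp
qed (simp add: bind_return_pmf)

lemma map_add_conv:
  assumes "finite J"
  shows "map_pmf (\<lambda>s. (\<Sum>m\<in>J. e m) + s) (conv.F f J) = conv.F (\<lambda>m. map_pmf (\<lambda>s. s + e m) (f m)) J"
  using assms
proof (induction J rule: finite_induct)
  case (insert j J)
  have "map_pmf (\<lambda>s. (e j + u) + s) (conv_pmf p q)
      = conv_pmf (map_pmf (\<lambda>s. s + e j) p) (map_pmf (\<lambda>s. u + s) q)" for u p q
    by (simp add: conv_pmf_def map_pmf_def bind_assoc_pmf bind_return_pmf ac_simps)
  with insert show ?case by simp
qed simp

lemma random_sum_eq: "random_sum Q V e = bind_pmf Q (\<lambda>n. map_pmf (\<lambda>v. e n + v) (conv_pow V n))"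
proof -
  have "(\<lambda>v. v + e n) = (\<lambda>v. e n + v)" for n
    by (simp only: add.commute)
  then show ?thesis by (simp add: random_sum_def)
qed

lemma total_eq_conv: "total P Q n = conv.F (\<lambda>m. random_sum (P m) (offspring Q m) (unit_vec m)) {..<n}"
  by (induction n) (simp_all add: lessThan_Suc conv.commute)

text \<open>Rewrites \<open>total\<close> in the sampling order of \<open>TN_law\<close>: first all
  counts, then the copies. Level 0 drops out, since \<open>offspring Q 0\<close> is the point mass
  at zero.\<close>

lemma total_Suc_eq_bind:
  "total P Q (Suc k) = bind_pmf (Pi_pmf {..k} d P)
     (\<lambda>t. map_pmf (\<lambda>s. (\<Sum>m\<le>k. unit_vec m (t m)) + s) (conv.F (\<lambda>m. conv_pow (offspring Q m) (t m)) {1..k}))"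
proof -
  have "conv.F (\<lambda>m. conv_pow (offspring Q m) (t m)) {1..k} = conv.F (\<lambda>m. conv_pow (offspring Q m) (t m)) {..k}" for t
    by (rule conv.mono_neutral_left) (auto simp: not_le)
  then show ?thesis
    using bind_Pi_pmf_conv[of "{..k}" d P "\<lambda>m n. map_pmf (\<lambda>s. s + unit_vec m n) (conv_pow (offspring Q m) n)"]
    by (simp add: total_eq_conv lessThan_Suc_atMost random_sum_def map_add_conv)
qed

lemma sum_fun_apply: "(\<Sum>j\<in>J. f j) i = (\<Sum>j\<in>J. f j i)"
  by (induction J rule: infinite_finite_induct) simp_all

text \<open>Extension by zero lets vectors of different dimensions be added pointwise.\<close>

definition vec_of :: "nat \<Rightarrow> nat list \<Rightarrow> (nat \<Rightarrow> nat)" where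
  "vec_of m xs = (\<lambda>i. if i < m then xs ! i else 0)"

definition list_pmf :: "nat \<Rightarrow> (nat \<Rightarrow> nat) pmf \<Rightarrow> nat list pmf" where
  "list_pmf m V = map_pmf (\<lambda>v. map v [0..<m]) V"

lemma map_vec_of_offspring: "map_pmf (vec_of m) (list_pmf m (offspring Q m)) = offspring Q m"
proof -
  have "map_pmf (vec_of m) (list_pmf m (offspring Q m)) = map_pmf (\<lambda>v. v) (offspring Q m)"
    unfolding list_pmf_def map_pmf_comp
    by (rule map_pmf_cong) (auto simp: vec_of_def fun_eq_iff set_pmf_offspring_vanish)
  then show ?thesis by simp
qed

section \<open>The construction for a fixed value of \<open>Z\<close>\<close>

context
  fixes k :: nat and \<delta> z :: real
  assumes \<delta>: "\<delta> > -1" and z: "z > 1"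
begin

private abbreviation (input) "b \<equiv> bcoef k \<delta>"
private abbreviation (input) "r m \<equiv> (1 + \<delta>) / b m"
private abbreviation (input) "\<kappa> m \<equiv> b (Suc m) / b m"
private abbreviation (input) "a m \<equiv> z powr (- (b m / b 0))"
private abbreviation (input) "P m \<equiv> NB_pmf (r m) (a m)"
private abbreviation (input) "Q m \<equiv> TNB_pmf (\<kappa> m) (a m)"
private abbreviation (input) "L m \<equiv> list_pmf m (offspring Q m)"

private lemma b_pos: "m \<le> k \<Longrightarrow> 0 < b m"
  using \<delta> by (rule bcoef_pos)

private lemma r_pos: "m \<le> k \<Longrightarrow> 0 < r m"
  using \<delta> b_pos by simp

private lemma \<kappa>: "Suc m \<le> k \<Longrightarrow> 0 < \<kappa> m \<and> \<kappa> m < 1"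
  using \<delta> b_pos[of m] b_pos[of "Suc m"] by (simp add: bcoef_Suc)

private lemma a_bounds: "m \<le> k \<Longrightarrow> 0 < a m" "m \<le> k \<Longrightarrow> a m < 1"
  using z b_pos[of m] b_pos[of 0] by (simp_all add: powr_less_one)

text \<open>The truncation constant of level \<open>m\<close> is thereby
  \<open>1 - a (Suc m)\<close>, which is what makes the product over levels telescope.\<close>

private lemma a_Suc: "m \<le> k \<Longrightarrow> a m powr \<kappa> m = a (Suc m)"
  using b_pos[of m] by (simp add: powr_powr)

private lemma NB_level: "m \<le> k \<Longrightarrow> NB (r m) (a m) = measure_pmf (P m)"
  by (intro NB_eq_pmf r_pos a_bounds)

private lemma TNB_level: "Suc m \<le> k \<Longrightarrow> TNB (\<kappa> m) (a m) = measure_pmf (Q m)"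
  using \<kappa>[of m] by (intro TNB_eq_pmf a_bounds) auto

text \<open>The parameters fit \<open>random_sum_NB_TNB\<close>:
  \<open>r m / \<kappa> m = r (Suc m)\<close> and
  \<open>a m powr \<kappa> m = a (Suc m)\<close>.\<close>

private lemma random_sum_level: "Suc m \<le> k \<Longrightarrow> random_sum (P (Suc m)) (Q m) (\<lambda>_. 0) = P m"
  using random_sum_NB_TNB[of "r m" "a m" "\<kappa> m"] r_pos[of m] a_bounds[of m] \<kappa>[of m] b_pos[of m]
  by (simp add: a_Suc)

private lemma N_law_eq_pmf: "m \<le> k \<Longrightarrow> N_law k \<delta> z m = measure_pmf (L m)"
proof (induction m)
  case 0
  show ?case by (simp add: list_pmf_def return_pmf.rep_eq)
next
  case (Suc m)
  let ?A = "measure_pmf (Q m)" and ?B = "PiM {1::nat..} (\<lambda>j. measure_pmf (L m))"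
  let ?F = "\<lambda>(t, x). unit_vec m t + (\<Sum>j\<in>{1..t}. vec_of m (x j))"
  have id: "(\<lambda>n. n) \<in> ?A \<rightarrow>\<^sub>M count_space UNIV" "distr ?A (count_space UNIV) (\<lambda>n. n) = ?A"
    by (simp, rule distr_id2, simp)
  have sub: "finite {1..t}" "{1..t} \<subseteq> {1..}" for t :: nat
    by auto
  have F: "?F \<in> ?A \<Otimes>\<^sub>M ?B \<rightarrow>\<^sub>M count_space UNIV"
    and law: "distr (?A \<Otimes>\<^sub>M ?B) (count_space UNIV) ?F
       = measure_pmf (bind_pmf (Q m) (\<lambda>t. map_pmf (\<lambda>s. unit_vec m t + s)
           (conv.F (\<lambda>j. map_pmf (vec_of m) (L m)) {1..t})))"
    using measurable_random_sum_PiM_pmf[OF measure_pmf.prob_space_axioms countableI_type id, where J = "\<lambda>t. {1..t}" and I = "{1..}"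
        and h = "unit_vec m" and g = "\<lambda>_. vec_of m" and Q = "\<lambda>_. L m"]
      distr_random_sum_PiM_pmf[OF measure_pmf.prob_space_axioms countableI_type id, where J = "\<lambda>t. {1..t}" and I = "{1..}"
        and h = "unit_vec m" and g = "\<lambda>_. vec_of m" and Q = "\<lambda>_. L m"] sub
    by auto
  \<comment> \<open>The list-valued map factors through addition of zero-extended functions, where
    the random sum lemma applies; the new count occupies coordinate \<open>m\<close>.\<close>
  have eq: "(\<lambda>(n, x). map (\<lambda>i. \<Sum>j=1..n. x j ! i) [0..<m] @ [n]) = (\<lambda>s. map s [0..<Suc m]) \<circ> ?F"
    by (auto simp: fun_eq_iff sum_fun_apply vec_of_def unit_vec_def)
  have "N_law k \<delta> z (Suc m) = distr (?A \<Otimes>\<^sub>M ?B) (count_space UNIV) ((\<lambda>s. map s [0..<Suc m]) \<circ> ?F)"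
    using Suc by (simp only: N_law.simps eq[symmetric]) (simp add: TNB_level)
  also have "\<dots> = distr (distr (?A \<Otimes>\<^sub>M ?B) (count_space UNIV) ?F) (count_space UNIV) (\<lambda>s. map s [0..<Suc m])"
    by (rule distr_distr[symmetric, OF _ F]) simp
  also have "distr (?A \<Otimes>\<^sub>M ?B) (count_space UNIV) ?F = measure_pmf (offspring Q (Suc m))"
    unfolding law by (simp add: map_vec_of_offspring conv_constant random_sum_eq)
  finally show ?case
    by (simp add: list_pmf_def map_pmf_rep_eq)
qed

private lemma TN_law_eq:
  "TN_law k \<delta> z = PiM {..k} (\<lambda>m. measure_pmf (P m)) \<Otimes>\<^sub>M PiM (TN_index k) (\<lambda>q. measure_pmf (L (fst q)))"
  unfolding TN_law_def
  by (intro arg_cong2[where f = "(\<Otimes>\<^sub>M)"] PiM_cong)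
     (auto simp: NB_level N_law_eq_pmf TN_index_def)

lemma sets_TN_law: "sets (TN_law k \<delta> z) = sets (TN_space k)"
  unfolding TN_law_eq TN_space_def
  by (intro sets_pair_measure_cong sets_PiM_cong) auto

text \<open>The counts enter only through their restriction to \<open>{..k}\<close>, which takes
  countably many values.\<close>

private lemma random_sum_TN:
  fixes h :: "(nat \<Rightarrow> nat) \<Rightarrow> 'c::comm_monoid_add" and g :: "nat \<times> nat \<Rightarrow> nat list \<Rightarrow> 'c"
  assumes J: "\<And>t. finite (J t)" "\<And>t. J t \<subseteq> TN_index k"
  shows "(\<lambda>(t, x). h (restrict t {..k}) + (\<Sum>q\<in>J (restrict t {..k}). g q (x q))) \<in> TN_law k \<delta> z \<rightarrow>\<^sub>M count_space UNIV"
    and "distr (TN_law k \<delta> z) (count_space UNIV) (\<lambda>(t, x). h (restrict t {..k}) + (\<Sum>q\<in>J (restrict t {..k}). g q (x q)))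
      = measure_pmf (bind_pmf (Pi_pmf {..k} undefined P)
          (\<lambda>t. map_pmf (\<lambda>s. h t + s) (conv.F (\<lambda>q. map_pmf (g q) (L (fst q))) (J t))))"
proof -
  have A: "prob_space (PiM {..k} (\<lambda>m. measure_pmf (P m)))"
    by (intro prob_space_PiM measure_pmf.prob_space_axioms)
  have C: "countable ({..k} \<rightarrow>\<^sub>E (UNIV :: nat set))"
    by (intro countable_PiE) auto
  note R = restrict_PiM_pmf[OF finite_atMost[of k] subset_refl, where Q = P]
  show "(\<lambda>(t, x). h (restrict t {..k}) + (\<Sum>q\<in>J (restrict t {..k}). g q (x q))) \<in> TN_law k \<delta> z \<rightarrow>\<^sub>M count_space UNIV"
    unfolding TN_law_eq by (rule measurable_random_sum_PiM_pmf[OF A C R J])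
  show "distr (TN_law k \<delta> z) (count_space UNIV) (\<lambda>(t, x). h (restrict t {..k}) + (\<Sum>q\<in>J (restrict t {..k}). g q (x q)))
      = measure_pmf (bind_pmf (Pi_pmf {..k} undefined P)
          (\<lambda>t. map_pmf (\<lambda>s. h t + s) (conv.F (\<lambda>q. map_pmf (g q) (L (fst q))) (J t))))"
    unfolding TN_law_eq by (rule distr_random_sum_PiM_pmf[OF A C R J])
qed

text \<open>Entry \<open>i\<close> of the copies is summed \<open>T_m\<close> times, a random sum
  with count law \<open>P m\<close>, which \<open>random_sum_marginal\<close> carries down to level
  \<open>i\<close>.\<close>

lemma TN_marginal:
  assumes "m \<le> k" "i < m"
  shows "distr (TN_law k \<delta> z) (count_space UNIV) (\<lambda>(t, x). \<Sum>j=1..t m. x (m, j) ! i) = NB (r i) (a i)"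
proof -
  have J: "finite ({m} \<times> {1..t m})" "{m} \<times> {1..t m} \<subseteq> TN_index k" for t :: "nat \<Rightarrow> nat"
    using assms by (auto simp: TN_index_def)
  have pair: "(\<Sum>q\<in>{m} \<times> {1..n}. f q) = (\<Sum>j=1..n. f (m, j))" for n and f :: "nat \<times> nat \<Rightarrow> nat"
  proof -
    have "{m} \<times> {1..n} = Pair m ` {1..n}" by auto
    then show ?thesis by (simp add: sum.reindex inj_on_def)
  qed
  have "(\<lambda>(t :: nat \<Rightarrow> nat, x). \<Sum>j=1..t m. x (m, j) ! i :: nat)
      = (\<lambda>(t, x). 0 + (\<Sum>q\<in>{m} \<times> {1..restrict t {..k} m}. x q ! i))"
    using assms by (simp add: pair del: One_nat_def)
  then have "distr (TN_law k \<delta> z) (count_space UNIV) (\<lambda>(t, x). \<Sum>j=1..t m. x (m, j) ! i)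
      = measure_pmf (bind_pmf (Pi_pmf {..k} undefined P)
          (\<lambda>t. conv.F (\<lambda>q. map_pmf (\<lambda>xs. xs ! i) (L (fst q))) ({m} \<times> {1..t m})))"
    using random_sum_TN(2)[of "\<lambda>t. {m} \<times> {1..t m}" "\<lambda>_. 0 :: nat" "\<lambda>_ xs. xs ! i"] J
    by (simp add: map_pmf_ident)
  also have "(\<lambda>t. conv.F (\<lambda>q. map_pmf (\<lambda>xs. xs ! i) (L (fst q))) ({m} \<times> {1..t m}))
      = (\<lambda>t. conv_pow (map_pmf (\<lambda>v. v i) (offspring Q m)) (t m))"
  proof
    fix t :: "nat \<Rightarrow> nat"
    have "conv.F (\<lambda>q. map_pmf (\<lambda>xs. xs ! i) (L (fst q))) ({m} \<times> {1..t m})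
        = conv.F (\<lambda>q. map_pmf (\<lambda>v. v i) (offspring Q m)) ({m} \<times> {1..t m})"
      using assms by (intro conv.cong) (auto simp: list_pmf_def map_pmf_comp)
    then show "conv.F (\<lambda>q. map_pmf (\<lambda>xs. xs ! i) (L (fst q))) ({m} \<times> {1..t m})
        = conv_pow (map_pmf (\<lambda>v. v i) (offspring Q m)) (t m)"
      by (simp add: conv_constant card_cartesian_product)
  qed
  also have "bind_pmf (Pi_pmf {..k} undefined P) (\<lambda>t. conv_pow (map_pmf (\<lambda>v. v i) (offspring Q m)) (t m))
      = bind_pmf (map_pmf (\<lambda>t. t m) (Pi_pmf {..k} undefined P)) (conv_pow (map_pmf (\<lambda>v. v i) (offspring Q m)))"
    by (simp add: bind_map_pmf)
  also have "\<dots> = random_sum (P m) (map_pmf (\<lambda>v. v i) (offspring Q m)) (\<lambda>_. 0)"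
    using assms by (simp add: Pi_pmf_component random_sum_def)
  also have "\<dots> = P i"
    using assms by (intro random_sum_marginal[where k = k] random_sum_level)
  finally show ?thesis
    using assms by (simp add: NB_level)
qed

private definition vec_TN :: "(nat \<Rightarrow> nat) \<times> (nat \<times> nat \<Rightarrow> nat list) \<Rightarrow> (nat \<Rightarrow> nat)" where
  "vec_TN = (\<lambda>(t, x). (\<Sum>m\<le>k. unit_vec m (restrict t {..k} m))
     + (\<Sum>q\<in>Sigma {1..k} (\<lambda>m. {1..restrict t {..k} m}). vec_of (fst q) (x q)))"

private lemma vec_TN:
  "vec_TN \<in> TN_law k \<delta> z \<rightarrow>\<^sub>M count_space UNIV"
  "distr (TN_law k \<delta> z) (count_space UNIV) vec_TN = measure_pmf (total P Q (Suc k))"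
proof -
  have J: "finite (Sigma {1..k} (\<lambda>m. {1..t m}))" "Sigma {1..k} (\<lambda>m. {1..t m}) \<subseteq> TN_index k" for t :: "nat \<Rightarrow> nat"
    by (auto simp: TN_index_def)
  have F: "conv.F (\<lambda>q. map_pmf (vec_of (fst q)) (L (fst q))) (Sigma {1..k} (\<lambda>m. {1..t m}))
      = conv.F (\<lambda>m. conv_pow (offspring Q m) (t m)) {1..k}" for t :: "nat \<Rightarrow> nat"
    using conv.Sigma[of "{1..k}" "\<lambda>m. {1..t m}" "\<lambda>m j. offspring Q m"]
    by (simp add: map_vec_of_offspring conv_constant split_def)
  show "vec_TN \<in> TN_law k \<delta> z \<rightarrow>\<^sub>M count_space UNIV"
    "distr (TN_law k \<delta> z) (count_space UNIV) vec_TN = measure_pmf (total P Q (Suc k))"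
    unfolding vec_TN_def
    using random_sum_TN[OF J, where h = "\<lambda>t. \<Sum>m\<le>k. unit_vec m (t m)" and g = "\<lambda>q. vec_of (fst q)"]
    by (simp_all only: F total_Suc_eq_bind[where d = undefined])
qed

private lemma vec_TN_apply:
  assumes "i \<le> k"
  shows "vec_TN (t, x) i = t i + (\<Sum>m=i+1..k. \<Sum>j=1..t m. x (m, j) ! i)"
proof -
  have "(\<Sum>m\<le>k. unit_vec m (restrict t {..k} m) i) = t i"
    using assms by (simp add: unit_vec_def)
  moreover have "(\<Sum>q\<in>Sigma {1..k} (\<lambda>m. {1..restrict t {..k} m}). vec_of (fst q) (x q) i)
      = (\<Sum>m=1..k. \<Sum>j=1..t m. vec_of m (x (m, j)) i)"
    by (subst sum.Sigma) (auto intro!: sum.cong simp: split_def)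
  moreover have "\<dots> = (\<Sum>m=i+1..k. \<Sum>j=1..t m. x (m, j) ! i)"
    by (rule sum.mono_neutral_cong_right) (auto simp: vec_of_def)
  ultimately show ?thesis
    by (simp add: vec_TN_def sum_fun_apply)
qed

definition degree_list :: "(nat \<Rightarrow> nat) \<Rightarrow> nat list" where
  "degree_list v = map (\<lambda>i. k - i + 1 + v i) [0..<Suc k]"

private lemma degree_list_excess:
  "length i = Suc k \<Longrightarrow> (\<And>j. j \<le> k \<Longrightarrow> k - j + 1 \<le> i ! j) \<Longrightarrow> degree_list (excess k i) = i"
  unfolding degree_list_def
proof (rule nth_equalityI)
  fix j assume i: "length i = Suc k" "\<And>j. j \<le> k \<Longrightarrow> k - j + 1 \<le> i ! j"
    and "j < length (map (\<lambda>j. k - j + 1 + excess k i j) [0..<Suc k])"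
  then have "j \<le> k" by simp
  with i(2)[of j] show "map (\<lambda>j. k - j + 1 + excess k i j) [0..<Suc k] ! j = i ! j"
    by (simp add: excess_def del: upt_Suc)
qed simp

text \<open>Each transition contributes the same power of \<open>z\<close>, and the powers of
  \<open>1 - a j\<close> telescope to the one at level 0, where \<open>a 0 = 1 / z\<close>.\<close>

private lemma pmf_total:
  assumes v: "\<And>j. j > k \<Longrightarrow> v j = 0"
  shows "pmf (total P Q (Suc k)) v
    = z powr (- ((1 + \<delta>) * real (Suc k) / b 0)) * (1 - 1 / z) ^ v 0 * chain_coeff k \<delta> v"
proof -
  have v': "(\<lambda>i. if i < Suc k then v i else 0) = v"
    using v by auto
  have "pmf (total P Q (Suc k)) v = (\<Prod>j<Suc k. pmf (conv_pmf (P j) (conv_pow (Q j) (v (Suc j)))) (v j))"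
    using pmf_total_given[of P Q "Suc k" v] v[of "Suc k"] by (simp only: total_given_0 v')
  also have "\<dots> = (\<Prod>j<Suc k. z powr (- ((1 + \<delta>) / b 0))
      * ((1 - a j) ^ v j / (1 - a (Suc j)) ^ v (Suc j)) * level_coeff k \<delta> j (v (Suc j)) (v j))"
  proof (intro prod.cong refl)
    fix j assume "j \<in> {..<Suc k}"
    then have j: "j \<le> k" by simp
    have \<kappa>j: "0 < \<kappa> j \<and> \<kappa> j < 1 \<or> v (Suc j) = 0"
      using \<kappa>[of j] v[of "Suc j"] j by (cases "Suc j \<le> k") auto
    have ar: "a j powr r j = z powr (- ((1 + \<delta>) / b 0))"
      using b_pos[OF j] by (simp add: powr_powr)
    show "pmf (conv_pmf (P j) (conv_pow (Q j) (v (Suc j)))) (v j) = z powr (- ((1 + \<delta>) / b 0))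
      * ((1 - a j) ^ v j / (1 - a (Suc j)) ^ v (Suc j)) * level_coeff k \<delta> j (v (Suc j)) (v j)"
      by (simp only: pmf_conv_NB_TNB[OF r_pos[OF j] a_bounds[OF j] \<kappa>j] ar a_Suc[OF j] level_coeff_def)
  qed
  also have "\<dots> = (z powr (- ((1 + \<delta>) / b 0))) ^ Suc k
      * (\<Prod>j<Suc k. (1 - a j) ^ v j / (1 - a (Suc j)) ^ v (Suc j)) * chain_coeff k \<delta> v"
    by (simp only: prod.distrib prod_constant card_lessThan chain_coeff_def flip: lessThan_Suc_atMost)
  also have "(\<Prod>j<Suc k. (1 - a j) ^ v j / (1 - a (Suc j)) ^ v (Suc j))
      = (1 - a 0) ^ v 0 / (1 - a (Suc k)) ^ v (Suc k)"
  proof (rule prod_lessThan_telescope')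
    show "(1 - a j) ^ v j \<noteq> 0" if "j \<le> Suc k" for j
      using a_bounds(2)[of j] v[of j] that by (cases "j \<le> k") auto
  qed
  also have "\<dots> = (1 - 1 / z) ^ v 0"
    using v[of "Suc k"] b_pos[of 0] z by (simp add: powr_minus divide_inverse)
  also have "(z powr (- ((1 + \<delta>) / b 0))) ^ Suc k = z powr (- ((1 + \<delta>) * real (Suc k) / b 0))"
    using z by (simp only: powr_realpow[symmetric] powr_gt_zero powr_powr) (simp add: mult.commute)
  finally show ?thesis .
qed

text \<open>On vectors supported in \<open>{..k}\<close> the map \<open>degree_list\<close> is
  injective with inverse \<open>excess k\<close>. Lists in its range that are not admissible get
  mass zero from \<open>chain_coeff_excess_eq_0\<close>.\<close>

private lemma pmf_degree_list:
  "pmf (map_pmf degree_list (total P Q (Suc k))) i = (if admissible k i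
     then z powr (- ((1 + \<delta>) * real (Suc k) / b 0)) * (1 - 1 / z) ^ excess k i 0 * chain_coeff k \<delta> (excess k i)
     else 0)"
proof (cases "length i = Suc k \<and> (\<forall>j\<le>k. k - j + 1 \<le> i ! j)")
  case True
  then have i: "degree_list (excess k i) = i"
    by (intro degree_list_excess) auto
  have unique: "degree_list w \<noteq> i" if "w \<noteq> excess k i" "w \<in> set_pmf (total P Q (Suc k))" for w
  proof
    assume w: "degree_list w = i"
    have "w j = excess k i j" for j
    proof (cases "j \<le> k")
      case True
      then show ?thesis
        unfolding w[symmetric] by (auto simp: degree_list_def excess_def simp del: upt_Suc)
    next
      case False
      then show ?thesis
        using set_pmf_total_given_vanish[of w P Q "Suc k" 0 j] that(2)
        by (simp add: total_given_0 excess_def)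
    qed
    with that(1) show False by auto
  qed
  have "pmf (map_pmf degree_list (total P Q (Suc k))) i
      = pmf (total P Q (Suc k)) (excess k i) * pmf (return_pmf (degree_list (excess k i))) i"
    unfolding map_pmf_def by (rule pmf_bind_single) (use unique in \<open>auto simp: pmf_eq_0_set_pmf\<close>)
  also have "\<dots> = z powr (- ((1 + \<delta>) * real (Suc k) / b 0)) * (1 - 1 / z) ^ excess k i 0 * chain_coeff k \<delta> (excess k i)"
    using pmf_total[of "excess k i"] i by (simp add: excess_def del: total.simps)
  finally show ?thesis
    using True chain_coeff_excess_eq_0[of i k \<delta>] by auto
next
  case False
  then have "i \<notin> set_pmf (map_pmf degree_list (total P Q (Suc k)))"
    by (auto simp: degree_list_def simp del: upt_Suc)
  moreover have "\<not> admissible k i"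
    using False by (metis admissible_def admissible_nth_ge)
  ultimately show ?thesis
    by (simp add: pmf_eq_0_set_pmf)
qed

lemma TN_degrees:
  defines "F \<equiv> \<lambda>(t, x). map (\<lambda>i. k - i + 1 + t i + (\<Sum>m=i+1..k. \<Sum>j=1..t m. x (m, j) ! i)) [0..<Suc k]"
  shows measurable_TN_degrees: "F \<in> TN_space k \<rightarrow>\<^sub>M count_space UNIV"
    and emeasure_TN_degrees: "emeasure (TN_law k \<delta> z) {w \<in> space (TN_space k). F w = i} = ennreal (if admissible k i
     then z powr (- ((1 + \<delta>) * real (Suc k) / b 0)) * (1 - 1 / z) ^ excess k i 0 * chain_coeff k \<delta> (excess k i)
     else 0)"
proof -
  have F: "F = degree_list \<circ> vec_TN"
    by (auto simp: F_def degree_list_def vec_TN_apply fun_eq_iff simp del: upt_Suc)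
  have m: "F \<in> TN_law k \<delta> z \<rightarrow>\<^sub>M count_space UNIV"
    unfolding F by (rule measurable_comp[OF vec_TN(1)]) simp
  then show "F \<in> TN_space k \<rightarrow>\<^sub>M count_space UNIV"
    by (simp add: measurable_cong_sets[OF sets_TN_law refl])
  have "emeasure (TN_law k \<delta> z) {w \<in> space (TN_space k). F w = i}
      = emeasure (distr (TN_law k \<delta> z) (count_space UNIV) F) {i}"
    by (subst emeasure_distr[OF m])
       (auto simp: sets_eq_imp_space_eq[OF sets_TN_law] intro!: arg_cong[where f = "emeasure _"])
  also have "distr (TN_law k \<delta> z) (count_space UNIV) F = measure_pmf (map_pmf degree_list (total P Q (Suc k)))"
    unfolding F by (simp add: map_pmf_rep_eq distr_distr[OF _ vec_TN(1), symmetric] vec_TN(2))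
  finally show "emeasure (TN_law k \<delta> z) {w \<in> space (TN_space k). F w = i} = ennreal (if admissible k i
     then z powr (- ((1 + \<delta>) * real (Suc k) / b 0)) * (1 - 1 / z) ^ excess k i 0 * chain_coeff k \<delta> (excess k i)
     else 0)"
    by (simp only: emeasure_pmf_single pmf_degree_list)
qed

text \<open>The coefficient is a probability divided by a positive factor, so its sign needs no
  analysis of the series.\<close>

lemma chain_coeff_excess_nonneg:
  assumes "admissible k i"
  shows "0 \<le> chain_coeff k \<delta> (excess k i)"
proof -
  have "0 \<le> (z powr (- ((1 + \<delta>) * real (Suc k) / b 0)) * (1 - 1 / z) ^ excess k i 0) * chain_coeff k \<delta> (excess k i)"
    using pmf_degree_list[of i] assms pmf_nonneg[of "map_pmf degree_list (total P Q (Suc k))" i]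
    by (simp only: if_True)
  moreover have "0 < z powr (- ((1 + \<delta>) * real (Suc k) / b 0)) * (1 - 1 / z) ^ excess k i 0"
    using z by simp
  ultimately show ?thesis
    by (simp only: zero_le_mult_iff) auto
qed

end

section \<open>Mixing over Z\<close>

text \<open>The common point masses on \<open>\<Omega>\<close> already sum to one, which leaves no
  mass for \<open>\<nu>\<close> elsewhere.\<close>

lemma prob_eqI_countable:
  assumes "prob_space \<mu>" "prob_space \<nu>" "sets \<mu> = UNIV" "sets \<nu> = UNIV"
    and "\<And>x. x \<notin> \<Omega> \<Longrightarrow> emeasure \<mu> {x} = 0"
    and eq: "\<And>x. x \<in> \<Omega> \<Longrightarrow> emeasure \<mu> {x} = emeasure \<nu> {x :: 'c::countable}"
  shows "\<mu> = \<nu>"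
proof -
  interpret \<mu>: prob_space \<mu> by fact
  interpret \<nu>: prob_space \<nu> by fact
  have sp: "space \<mu> = UNIV" "space \<nu> = UNIV"
    using assms(3,4) sets.top sets.sets_into_space by blast+
  have *: "emeasure M X = (\<integral>\<^sup>+x. emeasure M {x} \<partial>count_space X)" if "sets M = UNIV" for M and X :: "'c set"
    using that by (intro emeasure_countable_singleton) auto
  have "emeasure \<mu> (- \<Omega>) = 0"
    using assms(5) by (subst *[OF assms(3)]) (simp add: nn_integral_0_iff_AE AE_count_space)
  then have \<mu>: "AE x in \<mu>. x \<in> \<Omega>"
    using assms(3) by (intro AE_I[of _ _ "- \<Omega>"]) auto
  then have "emeasure \<mu> \<Omega> = 1"
    using assms(3) sp by (intro \<mu>.emeasure_eq_1_AE) auto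
  also have "emeasure \<mu> \<Omega> = emeasure \<nu> \<Omega>"
    unfolding *[OF assms(3), of \<Omega>] *[OF assms(4), of \<Omega>] by (intro nn_integral_cong) (simp add: eq)
  finally have "AE x in \<nu>. x \<in> \<Omega>"
    using \<nu>.AE_in_set_eq_1[of \<Omega>] assms(4) by (simp add: measure_def)
  with \<mu> show ?thesis
    using assms(3,4) by (intro measure_eqI_countable_AE eq) auto
qed

lemma emeasure_mixture_degrees:
  fixes k :: nat and \<delta> :: real and M :: "'a measure" and Z :: "'a \<Rightarrow> real"
    and X :: "'a \<Rightarrow> (nat \<Rightarrow> nat) \<times> (nat \<times> nat \<Rightarrow> nat list)"
  defines "F \<equiv> \<lambda>(t, x). map (\<lambda>i. k - i + 1 + t i + (\<Sum>m=i+1..k. \<Sum>j=1..t m. x (m, j) ! i)) [0..<Suc k]"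
  assumes \<delta>: "\<delta> > -1"
    and Z: "distributed M lborel Z
      (\<lambda>z. ennreal (if z \<ge> 1 then tau k \<delta> / bcoef k \<delta> 0 * z powr (- (1 + tau k \<delta> / bcoef k \<delta> 0)) else 0))"
      (is "distributed M lborel Z ?f")
    and X: "has_cond_law M Z (TN_space k) X (TN_law k \<delta>)"
  shows "emeasure M {\<omega> \<in> space M. F (X \<omega>) = i} = ennreal (degree_pmf k \<delta> i)"
proof -
  let ?b = "bcoef k \<delta> 0" and ?\<tau> = "tau k \<delta>" and ?v = "excess k i"
  let ?e = "(1 + \<delta>) * real (Suc k) / ?b"
  let ?C = "if admissible k i then chain_coeff k \<delta> ?v else 0"
  let ?w = "\<lambda>z. z powr (- ?e) * (1 - 1 / z) ^ ?v 0 * ?C"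
  define B where "B = {w \<in> space (TN_space k). F w = i}"
  have b: "0 < ?b" and \<tau>: "0 < ?\<tau>"
    using \<delta> by (auto intro: bcoef_pos tau_pos)
  have C: "0 \<le> ?C"
    \<comment> \<open>The coefficient does not depend on \<open>z\<close>, so any value above 1
      serves, here 2.\<close>
    using chain_coeff_excess_nonneg[of \<delta> 2 k i] \<delta> by simp
  have mX: "X \<in> M \<rightarrow>\<^sub>M TN_space k"
    using X by (simp add: has_cond_law_def)
  have mF: "F \<in> TN_space k \<rightarrow>\<^sub>M count_space UNIV"
    unfolding F_def using measurable_TN_degrees[of \<delta> 2 k] \<delta> by simp
  have "B = F -` {i} \<inter> space (TN_space k)"
    by (auto simp: B_def)
  with measurable_sets[OF mF, of "{i}"] have B: "B \<in> sets (TN_space k)"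
    by simp
  have K: "emeasure (TN_law k \<delta> z) B = ennreal (?w z)" if "1 < z" for z
    using emeasure_TN_degrees[OF \<delta> that, of k i] by (simp add: B_def F_def)
  have f: "?f \<in> borel_measurable lborel"
    using Z by (rule distributed_borel_measurable)
  have "{\<omega> \<in> space M. F (X \<omega>) = i} = {\<omega> \<in> space M. Z \<omega> \<in> UNIV \<and> X \<omega> \<in> B}"
    using measurable_space[OF mX] by (auto simp: B_def)
  then have "emeasure M {\<omega> \<in> space M. F (X \<omega>) = i} = (\<integral>\<^sup>+z. emeasure (TN_law k \<delta> z) B \<partial>distr M borel Z)"
    using X[unfolded has_cond_law_def, THEN conjunct2, rule_format, of UNIV B] B by simp
  also have "distr M borel Z = density lborel ?f"
    using distributed_distr_eq_density[OF Z] by (simp cong: distr_cong)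
  also have "(\<integral>\<^sup>+z. emeasure (TN_law k \<delta> z) B \<partial>density lborel ?f) = (\<integral>\<^sup>+z. ennreal (?w z) \<partial>density lborel ?f)"
  proof (rule nn_integral_cong_AE)
    \<comment> \<open>The density vanishes below 1 and the conditional law is controlled above 1;
      the point 1 is a null set.\<close>
    have "AE z in lborel. z \<noteq> (1 :: real)"
      by (rule AE_lborel_singleton)
    then show "AE z in density lborel ?f. emeasure (TN_law k \<delta> z) B = ennreal (?w z)"
      unfolding AE_density[OF f] by eventually_elim (auto simp: K)
  qed
  also have "\<dots> = (\<integral>\<^sup>+z. ?f z * ennreal (?w z) \<partial>lborel)"
    by (rule nn_integral_density[OF f]) measurable
  also have "\<dots> = (\<integral>\<^sup>+z. ennreal (?\<tau> / ?b * ?C *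
      (indicator {1..} z * (z powr (- (1 + decay k \<delta>)) * (1 - 1 / z) ^ ?v 0))) \<partial>lborel)"
  proof (rule nn_integral_cong)
    fix z :: real
    have "1 + decay k \<delta> = (1 + ?\<tau> / ?b) + ?e"
      by (simp add: decay_def add_divide_distrib)
    then have "z powr (- (1 + decay k \<delta>)) = z powr (- (1 + ?\<tau> / ?b)) * z powr (- ?e)"
      by (simp only: minus_add_distrib powr_add)
    then have "?\<tau> / ?b * z powr (- (1 + ?\<tau> / ?b)) * ?w z
        = ?\<tau> / ?b * ?C * (z powr (- (1 + decay k \<delta>)) * (1 - 1 / z) ^ ?v 0)"
      by (simp only: ac_simps)
    moreover have "0 \<le> ?\<tau> / ?b * z powr (- (1 + ?\<tau> / ?b))"
      using b \<tau> by simp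
    ultimately show "?f z * ennreal (?w z) = ennreal (?\<tau> / ?b * ?C *
      (indicator {1..} z * (z powr (- (1 + decay k \<delta>)) * (1 - 1 / z) ^ ?v 0)))"
      by (cases "1 \<le> z") (simp_all only: if_True if_False ennreal_mult'[symmetric] ennreal_0 mult_zero_left
        indicator_simps atLeast_iff mult_1_left mult_zero_right not_False_eq_True)
  qed
  also have "\<dots> = ennreal (?\<tau> / ?b * ?C * (fact (?v 0) / pochhammer (decay k \<delta>) (Suc (?v 0))))"
  proof -
    let ?g = "\<lambda>z. ?\<tau> / ?b * ?C * (indicator {1..} z * (z powr (- (1 + decay k \<delta>)) * (1 - 1 / z) ^ ?v 0))"
    have g: "has_bochner_integral lborel ?g (?\<tau> / ?b * ?C * (fact (?v 0) / pochhammer (decay k \<delta>) (Suc (?v 0))))"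
      by (intro has_bochner_integral_mult_right has_bochner_integral_powr_beta decay_pos \<delta>)
    have "0 \<le> ?g z" for z
    proof (cases "1 \<le> z")
      case True
      then show ?thesis
        using b \<tau> C by (intro mult_nonneg_nonneg zero_le_power) auto
    qed simp
    then show ?thesis
      using nn_integral_eq_integral[OF integrable.intros[OF g]]
      by (simp only: has_bochner_integral_integral_eq[OF g] AE_I2)
  qed
  also have "?\<tau> / ?b * ?C * (fact (?v 0) / pochhammer (decay k \<delta>) (Suc (?v 0))) = degree_pmf k \<delta> i"
    by (simp add: degree_pmf_def)
  finally show ?thesis .
qed

section \<open>Identification of the joint law and of the conditional marginals\<close>

theorem proposition2p3:
  fixes k :: nat and \<delta> :: real
    and p :: "nat list \<Rightarrow> real"
    and M' :: "'b measure" and D :: "nat \<Rightarrow> 'b \<Rightarrow> nat"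
    and M :: "'a measure" and Z :: "'a \<Rightarrow> real"
    and T :: "nat \<Rightarrow> 'a \<Rightarrow> nat"
    and N :: "nat \<Rightarrow> nat \<Rightarrow> nat \<Rightarrow> 'a \<Rightarrow> nat"
  assumes "\<delta> > -1"
    and "degree_recursion k \<delta> p"
    and "prob_space M'"
    and "\<And>m. m \<le> k \<Longrightarrow> D m \<in> measurable M' (count_space UNIV)"
    and "\<And>i. admissible k i \<Longrightarrow> measure M' {\<omega> \<in> space M'. \<forall>m\<le>k. D m \<omega> = i ! m} = p i"
    and "prob_space M"
    and "distributed M lborel Z
           (\<lambda>z. ennreal (if z \<ge> 1
              then tau k \<delta> / bcoef k \<delta> 0 * z powr (- (1 + tau k \<delta> / bcoef k \<delta> 0)) else 0))"
    and "has_cond_law M Z (TN_space k)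
           (\<lambda>\<omega>. (\<lambda>m\<in>{..k}. T m \<omega>,
                 \<lambda>(m, j)\<in>TN_index k. map (\<lambda>i. N m i j \<omega>) [0..<m]))
           (TN_law k \<delta>)"
  shows "distr M (count_space UNIV)
           (\<lambda>\<omega>. map (\<lambda>i. k - i + 1 + T i \<omega> + (\<Sum>m=i+1..k. \<Sum>j=1..T m \<omega>. N m i j \<omega>)) [0..<Suc k])
         = distr M' (count_space UNIV) (\<lambda>\<omega>. map (\<lambda>m. D m \<omega>) [0..<Suc k])
       \<and> (\<forall>z>1. \<forall>m\<le>k. \<forall>i<m.
           distr (TN_law k \<delta> z) (count_space UNIV) (\<lambda>(t, x). \<Sum>j=1..t m. x (m, j) ! i)
           = NB ((1 + \<delta>) / bcoef k \<delta> i) (z powr (- (bcoef k \<delta> i / bcoef k \<delta> 0))))"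
proof (intro conjI allI impI)
  interpret M: prob_space M by fact
  interpret M': prob_space M' by fact
  define X where "X = (\<lambda>\<omega>. (\<lambda>m\<in>{..k}. T m \<omega>, \<lambda>(m, j)\<in>TN_index k. map (\<lambda>i. N m i j \<omega>) [0..<m]))"
  define F :: "(nat \<Rightarrow> nat) \<times> (nat \<times> nat \<Rightarrow> nat list) \<Rightarrow> nat list" where
    "F = (\<lambda>(t, x). map (\<lambda>i. k - i + 1 + t i + (\<Sum>m=i+1..k. \<Sum>j=1..t m. x (m, j) ! i)) [0..<Suc k])"
  let ?V = "\<lambda>\<omega>. map (\<lambda>i. k - i + 1 + T i \<omega> + (\<Sum>m=i+1..k. \<Sum>j=1..T m \<omega>. N m i j \<omega>)) [0..<Suc k]"
  let ?D = "\<lambda>\<omega>. map (\<lambda>m. D m \<omega>) [0..<Suc k]"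
  have X: "has_cond_law M Z (TN_space k) X (TN_law k \<delta>)"
    unfolding X_def by fact
  have V: "?V = (\<lambda>\<omega>. F (X \<omega>))"
  proof
    fix \<omega>
    have "(\<Sum>j=1..T m \<omega>. N m i j \<omega>) = (\<Sum>j=1..T m \<omega>. snd (X \<omega>) (m, j) ! i)" if "m \<in> {i+1..k}" for i m
      using that by (intro sum.cong refl) (simp add: X_def TN_index_def)
    moreover have "fst (X \<omega>) m = T m \<omega>" if "m \<le> k" for m
      using that by (simp add: X_def)
    ultimately show "?V \<omega> = F (X \<omega>)"
      by (simp add: F_def split_def del: upt_Suc)
  qed
  have mV: "?V \<in> M \<rightarrow>\<^sub>M count_space UNIV"
    unfolding V
  proof (rule measurable_compose[where f = X and g = F and N = "TN_space k"])
    show "X \<in> M \<rightarrow>\<^sub>M TN_space k"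
      using X by (simp add: has_cond_law_def)
    show "F \<in> TN_space k \<rightarrow>\<^sub>M count_space UNIV"
      unfolding F_def using measurable_TN_degrees[of \<delta> 2 k] assms(1) by simp
  qed
  have "?D \<omega> = i \<longleftrightarrow> length i = Suc k \<and> (\<forall>m\<le>k. D m \<omega> = i ! m)" for i \<omega>
  proof -
    have "?D \<omega> = i \<longleftrightarrow> Suc k = length i \<and> (\<forall>m<Suc k. D m \<omega> = i ! m)"
      unfolding list_eq_iff_nth_eq length_map length_upt diff_zero
      by (intro conj_cong all_cong refl) (simp del: upt_Suc)
    then show ?thesis
      by (metis less_Suc_eq_le)
  qed
  then have D: "?D -` {i} \<inter> space M' = (if length i = Suc k then {\<omega> \<in> space M'. \<forall>m\<le>k. D m \<omega> = i ! m} else {})" for i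
    by (auto simp del: upt_Suc)
  have sets_D: "{\<omega> \<in> space M'. \<forall>m\<le>k. D m \<omega> = i ! m} \<in> sets M'" for i
  proof -
    have "{\<omega> \<in> space M'. D m \<omega> = i ! m} \<in> sets M'" if "m \<le> k" for m
      using measurable_sets[OF assms(4)[OF that], of "{i ! m}"] by (simp add: vimage_def Int_def conj_commute)
    then show ?thesis
      using sets.sets_Collect_finite_All'[of "{..k}" M' "\<lambda>m \<omega>. D m \<omega> = i ! m"] by simp
  qed
  have mD: "?D \<in> M' \<rightarrow>\<^sub>M count_space UNIV"
  proof (rule measurable_count_space_eq2_countable[THEN iffD2], intro conjI ballI)
    show "?D -` {a} \<inter> space M' \<in> sets M'" for a
      unfolding D by (cases "length a = Suc k") (simp_all only: if_True if_False simp_thms sets_D sets.empty_sets)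
  qed (rule Pi_I UNIV_I)+
  have V_law: "emeasure (distr M (count_space UNIV) ?V) {i} = ennreal (degree_pmf k \<delta> i)" for i
  proof -
    have "?V -` {i} \<inter> space M = {\<omega> \<in> space M. F (X \<omega>) = i}"
      unfolding V by auto
    then show ?thesis
      using emeasure_mixture_degrees[OF assms(1,7) X, of i, folded F_def]
      by (simp only: emeasure_distr[OF mV] sets_count_space Pow_UNIV UNIV_I)
  qed
  \<comment> \<open>The law of \<open>D\<close> is prescribed on admissible indices only, so
    uniqueness of the recursion is applied there and \<open>prob_eqI_countable\<close> covers the
    rest.\<close>
  have D_law: "emeasure (distr M' (count_space UNIV) ?D) {i} = ennreal (degree_pmf k \<delta> i)" if "admissible k i" for i
  proof -
    have "emeasure (distr M' (count_space UNIV) ?D) {i} = ennreal (p i)"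
      using that assms(5)[OF that] D[of i]
      by (simp add: emeasure_distr[OF mD] M'.emeasure_eq_measure admissible_def del: upt_Suc)
    also have "p i = degree_pmf k \<delta> i"
      by (intro degree_recursion_unique[OF assms(1,2)] degree_recursion_degree_pmf assms(1))
    finally show ?thesis .
  qed
  show "distr M (count_space UNIV) ?V = distr M' (count_space UNIV) ?D"
  proof (rule prob_eqI_countable[where \<Omega> = "{i. admissible k i}"])
    show "emeasure (distr M (count_space UNIV) ?V) {i} = 0" if "i \<notin> {i. admissible k i}" for i
      using that unfolding V_law by (simp add: degree_pmf_def)
    show "emeasure (distr M (count_space UNIV) ?V) {i} = emeasure (distr M' (count_space UNIV) ?D) {i}"
      if "i \<in> {i. admissible k i}" for i
      using that by (simp only: V_law D_law mem_Collect_eq)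
  qed (rule M.prob_space_distr[OF mV] M'.prob_space_distr[OF mD] | simp only: sets_distr sets_count_space Pow_UNIV)+
next
  fix z :: real and m i assume "1 < z" "m \<le> k" "i < m"
  then show "distr (TN_law k \<delta> z) (count_space UNIV) (\<lambda>(t, x). \<Sum>j=1..t m. x (m, j) ! i)
      = NB ((1 + \<delta>) / bcoef k \<delta> i) (z powr (- (bcoef k \<delta> i / bcoef k \<delta> 0)))"
    by (rule TN_marginal[OF assms(1)])
qed

end
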